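(* Let $d, e \in \mathbb{N}_0$ with $d \equiv e \pmod 2$. The extreme rays of $\mathcal{C}_{d,e}$ are exactly the rays generated by the polynomials of the form $r(X)\,(p(X)Y + q(X)Z)^2$ with $p, q, r \in \mathbb{R}[X]$ such that - $p$ and $q$ are not simultaneously zero and $\gcd(p,q) = 1$; - $r \ne 0$, $r \ge 0$ on $[0,1]$, and $r$ has $\deg r$ real roots in $[0,1]$ (counted with multiplicity); - $2\deg p \le d$, $2 \deg q \le e$ and $\deg r = \min\{d - 2\deg p,\ e - 2\deg q\}$.
   Context: Let $\mathcal{S} = [0,1] \times (\mathbb{R}^2 \setminus \{(0,0)\}) \subseteq \mathbb{R}^3$. For $d, e \in \mathbb{N}_0$, $\mathcal{C}_{d,e}$ is the set of all polynomials $$\bar f = f_2(X)Y^2 + f_1(X)YZ + f_0(X)Z^2 \in \mathbb{R}[X,Y,Z]$$ such that $\bar f \ge 0$ on $\mathcal{S}$, $\deg f_2 \le d$, $\deg f_1 \le \lfloor \tfrac12(d+e)\rfloor$ and $\deg f_0 \le e$. Identifying polynomials with their coefficient vectors, $\mathcal{C}_{d,e}$ is a closed convex cone, containing no lines, in a finite-dimensional real vector space. A nonzero $\bar f \in \mathcal{C}_{d,e}$ generates an extreme ray of $\mathcal{C}_{d,e}$ if whenever $\bar f = g + h$ with $g, h \in \mathcal{C}_{d,e}$, both $g$ and $h$ are scalar multiples of $\bar f$ (equivalently: every $g \in \mathcal{C}_{d,e}$ with $0 \le g \le \bar f$ on $\mathcal{S}$ is a scalar multiple of $\bar f$); the extreme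 ray is then $\{\lambda \bar f \mid \lambda \ge 0\}$. Convention: $\deg 0 = -\infty$, so that if $p = 0$ (respectively $q=0$) the corresponding term $d - 2\deg p$ (respectively $e - 2 \deg q$) in the minimum is $+\infty$. *)

theory Defs
  imports
    "HOL-Analysis.Analysis"
    "HOL-Computational_Algebra.Computational_Algebra"
    "HOL-Computational_Algebra.Field_as_Ring"
    "HOL-Library.Extended_Nat"
begin

text \<open>
  The ring \<open>\<real>[X,Y,Z]\<close> is rendered as the iterated polynomial ring \<open>\<real>[X][Y][Z]\<close>:
  the innermost variable is \<open>X\<close>, the outermost one is \<open>Z\<close>.
\<close>

type_synonym poly3 = "real poly poly poly"

definition of_X :: "real poly \<Rightarrow> poly3" where
  "of_X p = [:[:p:]:]"

definition var_Y :: poly3 where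
  "var_Y = [:[:0, 1:]:]"

definition var_Z :: poly3 where
  "var_Z = [:0, 1:]"

definition scale3 :: "real \<Rightarrow> poly3 \<Rightarrow> poly3" where
  "scale3 c F = of_X [:c:] * F"

definition eval3 :: "poly3 \<Rightarrow> real \<times> real \<times> real \<Rightarrow> real" where
  "eval3 F = (\<lambda>(x, y, z). poly (poly (poly F [:[:z:]:]) [:y:]) x)"

lemma eval3_simps:
  "eval3 (of_X p) (x, y, z) = poly p x"
  "eval3 var_Y (x, y, z) = y"
  "eval3 var_Z (x, y, z) = z"
  "eval3 (F + G) v = eval3 F v + eval3 G v"
  "eval3 (F * G) v = eval3 F v * eval3 G v"
  "eval3 (F ^ n) v = eval3 F v ^ n"
  "eval3 (scale3 c F) v = c * eval3 F v"
  by (auto simp: eval3_def of_X_def var_Y_def var_Z_def scale3_def split: prod.splits)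

definition strip :: "(real \<times> real \<times> real) set" where
  "strip = {0..1} \<times> (UNIV - {(0, 0)})"

text \<open>
  The library has \<open>degree 0 = 0\<close> instead of \<open>-\<infinity>\<close>; this is immaterial for upper
  bounds by natural numbers.
\<close>

definition cone_C :: "nat \<Rightarrow> nat \<Rightarrow> poly3 set" where
  "cone_C d e =
    {F. (\<exists>f2 f1 f0 :: real poly.
           F = of_X f2 * var_Y ^ 2 + of_X f1 * var_Y * var_Z + of_X f0 * var_Z ^ 2 \<and>
           degree f2 \<le> d \<and> degree f1 \<le> (d + e) div 2 \<and> degree f0 \<le> e) \<and>
        (\<forall>v\<in>strip. 0 \<le> eval3 F v)}"

definition generates_extreme_ray :: "poly3 set \<Rightarrow> poly3 \<Rightarrow> bool" where
  "generates_extreme_ray K F \<longleftrightarrow>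
    F \<in> K \<and> F \<noteq> 0 \<and>
    (\<forall>G\<in>K. \<forall>H\<in>K. F = G + H \<longrightarrow> (\<exists>a. G = scale3 a F) \<and> (\<exists>b. H = scale3 b F))"

definition ray :: "poly3 \<Rightarrow> poly3 set" where
  "ray F = {scale3 c F |c. 0 \<le> c}"

definition extreme_rays :: "poly3 set \<Rightarrow> poly3 set set" where
  "extreme_rays K = {ray F |F. generates_extreme_ray K F}"

text \<open>
  \<open>codeg d p\<close> is \<open>d - 2 deg p\<close> with the convention \<open>deg 0 = -\<infinity>\<close>.  It is only meaningful
  if \<open>2 * degree p \<le> d\<close>, since subtraction on \<open>nat\<close> truncates.
\<close>

definition codeg :: "nat \<Rightarrow> real poly \<Rightarrow> enat" where
  "codeg d p = (if p = 0 then \<infinity> else enat (d - 2 * degree p))"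

end

theory Submission
  imports Defs
begin

text \<open>
  Write a form as \<open>a Y\<^sup>2 + 2 b Y Z + c Z\<^sup>2\<close> with determinant \<open>\<Delta> = a c - b\<^sup>2\<close>.  If \<open>\<Delta> \<noteq> 0\<close>, one finds
  by induction on \<open>d + e\<close> a nonzero rank-one form \<open>r (p Y + q Z)\<^sup>2\<close> in the cone below it, so it is not
  extreme.  A root \<open>t\<close> of \<open>\<Delta>\<close> in \<open>[0,1]\<close> can be moved by exchanging \<open>Y\<close> and \<open>Z\<close> or by a shear
  \<open>Z \<mapsto> Z + s Y\<close> to a root of \<open>a\<close>; then either the substitution \<open>(X - t) Y\<close> for \<open>Y\<close> or a common linear
  factor reduces the degrees, or \<open>t\<close> is an endpoint and a simple root of \<open>\<Delta>\<close>.  If only the latter occurs,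
  a rank-one form whose kernel agrees at the roots of \<open>\<Delta>\<close> with that of the given form (or which vanishes
  there) is dominated by it.

  If \<open>\<Delta> = 0\<close>, then the form is \<open>r (p Y + q Z)\<^sup>2\<close> with \<open>p, q\<close> coprime, and the decompositions
  \<open>r = X r + (1 - X) r\<close> and \<open>r = \<mu> t + (l - \<mu>) t\<close>, where \<open>r = l t\<close> and \<open>l \<ge> \<mu> > 0\<close> on \<open>[0,1]\<close>, force the
  conditions on \<open>r\<close>.  Conversely, a form below \<open>r (p Y + q Z)\<^sup>2\<close> has the same kernel, hence is
  \<open>s (p Y + q Z)\<^sup>2\<close> with \<open>0 \<le> s \<le> r\<close> on \<open>[0,1]\<close>; so \<open>s\<close> inherits the roots of \<open>r\<close>, and the degree bound
  makes it a multiple of \<open>r\<close>.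
\<close>

subsection \<open>Real polynomials on the unit interval\<close>

text \<open>Products with \<open>[:-a, 1:]\<close> stay factored under simplification.\<close>

declare mult_pCons_left [simp del]

lemma poly_eq_0_if_zero_on_unit_interval:
  fixes p :: "real poly"
  assumes "\<And>x. x \<in> {0..1} \<Longrightarrow> poly p x = 0"
  shows "p = 0"
proof (rule ccontr)
  assume "p \<noteq> 0"
  then have "finite {x. poly p x = 0}" by (rule poly_roots_finite)
  moreover have "{0..1} \<subseteq> {x. poly p x = 0}" using assms by auto
  ultimately have "finite {0..1::real}" by (rule rev_finite_subset)
  then show False by (simp add: infinite_Icc)
qed

text \<open>Roots of \<open>g\<close> are isolated, so every point of the interval, endpoints
  included, is a limit of points of the interval where \<open>nonneg\<close> applies. This permits
  dividing pointwise by a factor or by the determinant.\<close>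

lemma poly_nonneg_off_roots:
  fixes f g :: "real poly"
  assumes "g \<noteq> 0"
    and nonneg: "\<And>x. x \<in> {0..1} \<Longrightarrow> poly g x \<noteq> 0 \<Longrightarrow> 0 \<le> poly f x"
    and "x \<in> {0..1}"
  shows "0 \<le> poly f x"
proof (rule ccontr)
  assume "\<not> 0 \<le> poly f x"
  moreover have "isCont (poly f) x" by simp
  ultimately have "eventually (\<lambda>y. poly f y < 0) (at x)"
    by (intro order_tendstoD(2)[of _ "poly f x"]) (auto simp: isCont_def)
  moreover have "eventually (\<lambda>y. poly g y \<noteq> 0) (at x)"
  proof -
    have "finite ({y. poly g y = 0} - {x})"
      using poly_roots_finite[OF \<open>g \<noteq> 0\<close>] by simp
    then have "open (- ({y. poly g y = 0} - {x}))"
      by (intro open_Compl finite_imp_closed)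
    then have "eventually (\<lambda>y. y \<in> - ({y. poly g y = 0} - {x})) (nhds x)"
      by (rule eventually_nhds_in_open) simp
    then show ?thesis
      by (auto simp: eventually_at_filter elim: eventually_mono)
  qed
  ultimately have "eventually (\<lambda>y. poly f y < 0 \<and> poly g y \<noteq> 0) (at x within {0..1})"
    by (rule filter_leD[OF at_le[OF subset_UNIV] eventually_conj])
  moreover have "eventually (\<lambda>y. y \<in> {0..1}) (at x within {0..1})"
    by (simp add: eventually_at_filter)
  ultimately have "eventually (\<lambda>y. False) (at x within {0..1})"
  proof eventually_elim
    case (elim y)
    then show ?case using nonneg[of y] by simp
  qed
  moreover have "at x within {0..1} \<noteq> bot"
    using \<open>x \<in> {0..1}\<close> by (simp add: trivial_limit_within islimpt_Icc)
  ultimately show False by (simp add: trivial_limit_def)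
qed

text \<open>The intermediate value theorem gives a constant sign; compactness bounds the minimum
  away from zero.\<close>

lemma poly_no_root_sign:
  fixes l :: "real poly"
  assumes "\<And>x. x \<in> {0..1} \<Longrightarrow> poly l x \<noteq> 0"
  obtains s \<mu> :: real where "s \<noteq> 0" "\<mu> > 0" "\<And>x. x \<in> {0..1} \<Longrightarrow> \<mu> \<le> s * poly l x"
proof -
  define s where "s = sgn (poly l 0)"
  have "s \<noteq> 0" using assms[of 0] by (simp add: s_def sgn_0_0)
  have pos: "0 < s * poly l x" if "x \<in> {0..1}" for x
  proof (rule ccontr)
    assume "\<not> ?thesis"
    then have "poly (smult s l) x \<le> 0" by simp
    moreover have "0 \<le> poly (smult s l) 0" by (simp add: s_def sgn_if)
    moreover have "continuous_on {0..x} (poly (smult s l))"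
      by (intro continuous_intros)
    ultimately have "\<exists>y. 0 \<le> y \<and> y \<le> x \<and> poly (smult s l) y = 0"
      using that by (intro IVT2') auto
    then show False using assms \<open>s \<noteq> 0\<close> that by fastforce
  qed
  obtain y where y: "y \<in> {0..1::real}" "\<And>x. x \<in> {0..1} \<Longrightarrow> s * poly l y \<le> s * poly l x"
    using continuous_attains_inf[of "{0..1::real}" "\<lambda>x. s * poly l x"]
    by (force intro: continuous_intros)
  show thesis using that[of s "s * poly l y"] \<open>s \<noteq> 0\<close> y pos by blast
qed

text \<open>The multiset \<open>A\<close> records multiplicities; \<open>l\<close> keeps the roots
  outside the interval and the nonreal ones.\<close>

lemma poly_unit_interval_root_factorization:
  fixes r :: "real poly"
  assumes "r \<noteq> 0"
  obtains A l where "r = (\<Prod>a\<in>#A. [:-a, 1:]) * l" "set_mset A \<subseteq> {0..1}"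
    "\<And>x. x \<in> {0..1} \<Longrightarrow> poly l x \<noteq> 0"
proof -
  have "\<exists>A l. r = (\<Prod>a\<in>#A. [:-a, 1:]) * l \<and> set_mset A \<subseteq> {0..1} \<and> (\<forall>x\<in>{0..1}. poly l x \<noteq> 0)"
    using assms
  proof (induction "degree r" arbitrary: r rule: less_induct)
    case less
    show ?case
    proof (cases "\<exists>x\<in>{0..1}. poly r x = 0")
      case False
      then show ?thesis by (intro exI[of _ "{#}"] exI[of _ r]) simp
    next
      case True
      then obtain x where x: "x \<in> {0..1}" "poly r x = 0" by blast
      then obtain k where k: "r = [:-x, 1:] * k" by (auto simp: poly_eq_0_iff_dvd)
      with less.prems have "k \<noteq> 0" by auto
      then have "degree k < degree r" unfolding k by (subst degree_mult_eq) auto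
      from less.hyps[OF this \<open>k \<noteq> 0\<close>] obtain A l where
        "k = (\<Prod>a\<in>#A. [:-a, 1:]) * l" "set_mset A \<subseteq> {0..1}" "\<forall>x\<in>{0..1}. poly l x \<noteq> 0"
        by blast
      then show ?thesis using k x
        by (intro exI[of _ "add_mset x A"] exI[of _ l]) (auto simp: mult.assoc)
    qed
  qed
  then show thesis using that by blast
qed

lemma prod_linear_neq_0: "(\<Prod>a\<in>#A. [:-a, 1:]) \<noteq> (0 :: real poly)"
  by (induction A) auto

lemma proots_prod_linear: "proots (\<Prod>a\<in>#A. [:-a, 1:]) = (A :: real multiset)"
proof (induction A)
  case (add x A)
  have "proots ([:-x, 1:] * (\<Prod>a\<in>#A. [:-a, 1:])) = proots [:-x, 1:] + proots (\<Prod>a\<in>#A. [:-a, 1:])"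
    by (rule proots_mult) (use prod_linear_neq_0[of A] in auto)
  with add show ?case by simp
qed simp

lemma degree_prod_linear: "degree (\<Prod>a\<in>#A. [:-a, 1:] :: real poly) = size A"
proof (induction A)
  case (add x A)
  have "degree ([:-x, 1:] * (\<Prod>a\<in>#A. [:-a, 1:])) = degree [:-x, 1:] + degree (\<Prod>a\<in>#A. [:-a, 1:])"
    by (rule degree_mult_eq) (use prod_linear_neq_0[of A] in auto)
  with add show ?case by simp
qed simp

text \<open>\<open>A\<close> collects exactly the roots of \<open>r\<close> in the interval and has
  size \<open>degree r - degree l\<close>, so the root count in the theorem says that
  \<open>l\<close> is constant.\<close>

lemma size_unit_interval_proots:
  fixes l :: "real poly"
  assumes "set_mset A \<subseteq> {0..1}" "\<And>x. x \<in> {0..1} \<Longrightarrow> poly l x \<noteq> 0"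
  defines "r \<equiv> (\<Prod>a\<in>#A. [:-a, 1:]) * l"
  shows "size (filter_mset (\<lambda>x. x \<in> {0..1}) (proots r)) = degree r \<longleftrightarrow> degree l = 0"
proof -
  have "l \<noteq> 0" using assms(2)[of 0] by auto
  have "filter_mset (\<lambda>x. x \<in> {0..1}) A = A"
    using assms(1) by (auto intro!: filter_mset_eq_conv[THEN iffD2] multiset_eqI simp: filter_mset_eq_conv)
  moreover have "filter_mset (\<lambda>x. x \<in> {0..1}) (proots l) = {#}"
    using assms(2) \<open>l \<noteq> 0\<close> by (intro multiset_eqI) (auto simp: order_root)
  moreover have "proots r = A + proots l"
    unfolding r_def using proots_mult[of "\<Prod>a\<in>#A. [:-a, 1:]" l] \<open>l \<noteq> 0\<close> prod_linear_neq_0[of A]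
    by (metis mult_eq_0_iff proots_prod_linear)
  moreover have "degree r = size A + degree l"
    unfolding r_def using degree_mult_eq[OF prod_linear_neq_0 \<open>l \<noteq> 0\<close>] degree_prod_linear by metis
  ultimately have "size (filter_mset (\<lambda>x. x \<in> {0..1}) (proots r)) = size A" by simp
  with \<open>degree r = size A + degree l\<close> show ?thesis by simp
qed

section \<open>Domination between polynomials on the unit interval\<close>

text \<open>Cancelling is immediate away from \<open>a\<close>; squaring makes the inequality
  polynomial, so that it extends to \<open>a\<close> by continuity.\<close>

lemma abs_poly_le_linear_factor:
  fixes s r :: "real poly"
  assumes "\<And>x. x \<in> {0..1} \<Longrightarrow> \<bar>poly ([:-a, 1:] * s) x\<bar> \<le> \<bar>poly ([:-a, 1:] * r) x\<bar>"
    and "x \<in> {0..1}"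
  shows "\<bar>poly s x\<bar> \<le> \<bar>poly r x\<bar>"
proof -
  have "0 \<le> poly (r ^ 2 - s ^ 2) x"
  proof (rule poly_nonneg_off_roots[of "[:-a, 1:]"])
    fix y :: real assume "y \<in> {0..1}" "poly [:-a, 1:] y \<noteq> 0"
    then have "\<bar>poly s y\<bar> \<le> \<bar>poly r y\<bar>"
      using assms(1)[of y] by (simp add: abs_mult)
    then show "0 \<le> poly (r ^ 2 - s ^ 2) y" by (simp add: abs_le_square_iff)
  qed (use assms(2) in auto)
  then show ?thesis by (simp add: abs_le_square_iff)
qed

text \<open>The bound forces \<open>s\<close> to vanish at a listed root; it persists after
  cancelling that factor on both sides, so multiplicities are respected.\<close>

lemma dvd_if_dominated_and_split:
  fixes s :: "real poly"
  assumes "set_mset A \<subseteq> {0..1}"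
    and "\<And>x. x \<in> {0..1} \<Longrightarrow> \<bar>poly s x\<bar> \<le> \<bar>poly (smult c (\<Prod>a\<in>#A. [:-a, 1:])) x\<bar>"
  shows "(\<Prod>a\<in>#A. [:-a, 1:]) dvd s"
  using assms
proof (induction A arbitrary: s)
  case empty
  show ?case by simp
next
  case (add a A)
  have split_a: "smult c (\<Prod>b\<in>#add_mset a A. [:-b, 1:]) = [:-a, 1:] * smult c (\<Prod>b\<in>#A. [:-b, 1:])"
    by (simp only: image_mset_add_mset prod_mset.add_mset mult_smult_right)
  have bound: "\<bar>poly s x\<bar> \<le> \<bar>poly ([:-a, 1:] * smult c (\<Prod>b\<in>#A. [:-b, 1:])) x\<bar>" if "x \<in> {0..1}" for x
    using add.prems(2)[OF that] unfolding split_a .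
  have "a \<in> {0..1}" using add.prems(1) by simp
  from bound[OF this] have "poly s a = 0" by (simp only: poly_mult) simp
  then obtain k where k: "s = [:-a, 1:] * k" by (auto simp: poly_eq_0_iff_dvd)
  have "(\<Prod>a\<in>#A. [:-a, 1:]) dvd k"
  proof (rule add.IH)
    show "\<bar>poly k x\<bar> \<le> \<bar>poly (smult c (\<Prod>a\<in>#A. [:-a, 1:])) x\<bar>" if "x \<in> {0..1}" for x
      using that bound unfolding k by (rule abs_poly_le_linear_factor[rotated])
    show "set_mset A \<subseteq> {0..1}" using add.prems(1) by simp
  qed
  then show ?case
    by (simp only: k image_mset_add_mset prod_mset.add_mset mult_dvd_mono dvd_refl)
qed

text \<open>Common roots in the interval are cancelled one by one; simplicity keeps the cofactor of
  \<open>f\<close> nonzero at a cancelled root. Once \<open>f\<close> has no root left there,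
  compactness gives the constant.\<close>

lemma abs_poly_bounded_by_multiple:
  fixes f g :: "real poly"
  assumes "f \<noteq> 0"
    and "\<And>x. x \<in> {0..1} \<Longrightarrow> poly f x = 0 \<Longrightarrow> poly g x = 0 \<and> \<not> [:-x, 1:] ^ 2 dvd f"
  obtains C where "C > 0" "\<And>x. x \<in> {0..1} \<Longrightarrow> \<bar>poly g x\<bar> \<le> C * \<bar>poly f x\<bar>"
proof -
  have "\<exists>C>0. \<forall>x\<in>{0..1}. \<bar>poly g x\<bar> \<le> C * \<bar>poly f x\<bar>"
    using assms
  proof (induction "degree f" arbitrary: f g rule: less_induct)
    case less
    show ?case
    proof (cases "\<exists>a\<in>{0..1}. poly f a = 0")
      case True
      then obtain a where a: "a \<in> {0..1}" "poly f a = 0" by blast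
      then obtain k where k: "f = [:-a, 1:] * k" by (auto simp: poly_eq_0_iff_dvd)
      from a less.prems obtain m where m: "g = [:-a, 1:] * m" by (metis poly_eq_0_iff_dvd dvdE)
      from k less.prems have "k \<noteq> 0" by auto
      then have "degree k < degree f" unfolding k by (subst degree_mult_eq) auto
      then have "\<exists>C>0. \<forall>x\<in>{0..1}. \<bar>poly m x\<bar> \<le> C * \<bar>poly k x\<bar>"
      proof (rule less.hyps)
        fix x :: real assume x: "x \<in> {0..1}" "poly k x = 0"
        then have fx: "poly f x = 0" by (simp add: k)
        have nd: "\<not> [:-x, 1:] ^ 2 dvd f" using less.prems(2) x(1) fx by blast
        have "x \<noteq> a"
        proof
          assume "x = a"
          with x have "[:-a, 1:] dvd k" by (simp add: poly_eq_0_iff_dvd)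
          then have "[:-a, 1:] * [:-a, 1:] dvd f" unfolding k by (rule mult_dvd_mono[OF dvd_refl])
          with nd \<open>x = a\<close> show False by (simp add: power2_eq_square)
        qed
        moreover have "poly g x = 0" using less.prems(2) x(1) fx by blast
        ultimately have "poly m x = 0" by (simp add: m)
        moreover have "\<not> [:-x, 1:] ^ 2 dvd k" using nd unfolding k by (metis dvd_mult)
        ultimately show "poly m x = 0 \<and> \<not> [:-x, 1:] ^ 2 dvd k" by blast
      qed fact
      then obtain C where "C > 0" and C: "\<And>x. x \<in> {0..1} \<Longrightarrow> \<bar>poly m x\<bar> \<le> C * \<bar>poly k x\<bar>" by blast
      have "\<bar>poly g x\<bar> \<le> C * \<bar>poly f x\<bar>" if "x \<in> {0..1}" for x
        using mult_left_mono[OF C[OF that], of "\<bar>poly [:-a, 1:] x\<bar>"]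
        by (simp only: k m poly_mult abs_mult mult_ac)
      with \<open>C > 0\<close> show ?thesis by blast
    next
      case False
      then obtain s \<mu> where s: "s \<noteq> 0" "\<mu> > 0" "\<And>x. x \<in> {0..1} \<Longrightarrow> \<mu> \<le> s * poly f x"
        using poly_no_root_sign[of f] by blast
      have "compact (poly g ` {0..1})"
        by (intro compact_continuous_image continuous_intros) auto
      then obtain B where B: "B > 0" "\<And>x. x \<in> {0..1} \<Longrightarrow> \<bar>poly g x\<bar> \<le> B"
        by (auto dest!: compact_imp_bounded simp: bounded_pos)
      have "\<bar>poly g x\<bar> \<le> (B * \<bar>s\<bar> / \<mu>) * \<bar>poly f x\<bar>" if "x \<in> {0..1}" for x
      proof -
        have "\<mu> \<le> \<bar>s\<bar> * \<bar>poly f x\<bar>" using s(3)[OF that] by (metis abs_ge_self abs_mult order_trans)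
        then have "B * \<mu> \<le> B * (\<bar>s\<bar> * \<bar>poly f x\<bar>)" using B(1) by simp
        then have "B \<le> (B * \<bar>s\<bar> / \<mu>) * \<bar>poly f x\<bar>" using s(2) by (simp add: field_simps)
        with B(2)[OF that] show ?thesis by linarith
      qed
      moreover have "B * \<bar>s\<bar> / \<mu> > 0" using s B by simp
      ultimately show ?thesis by blast
    qed
  qed
  then show thesis using that by blast
qed

text \<open>An interior zero is a local minimum, so the derivative vanishes at \<open>a\<close>, and
  there it equals the cofactor of \<open>[:-a, 1:]\<close>.\<close>

lemma linear_power2_dvd_if_nonneg:
  fixes f :: "real poly"
  assumes "\<And>x. x \<in> {0..1} \<Longrightarrow> 0 \<le> poly f x" "0 < a" "a < 1" "poly f a = 0"
  shows "[:-a, 1:] ^ 2 dvd f"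
proof -
  obtain k where k: "f = [:-a, 1:] * k" using assms(4) by (auto simp: poly_eq_0_iff_dvd)
  have "poly k a = 0"
  proof (rule DERIV_local_min[of "poly f" _ _ "min a (1 - a)", THEN trans[rotated]])
    show "(poly f has_real_derivative poly (pderiv f) a) (at a)" by (rule poly_DERIV)
    show "0 < min a (1 - a)" using assms by simp
    show "\<forall>y. \<bar>a - y\<bar> < min a (1 - a) \<longrightarrow> poly f a \<le> poly f y"
      using assms by (auto simp: abs_if split: if_splits)
    show "poly k a = poly (pderiv f) a" unfolding k by (simp add: pderiv_mult pderiv_pCons)
  qed
  then show ?thesis by (simp only: k power2_eq_square poly_eq_0_iff_dvd mult_dvd_mono dvd_refl)
qed

subsection \<open>Nonnegative binary quadratic forms over the interval\<close>

text \<open>The vectors \<open>(-b, a)\<close> and \<open>(c, -b)\<close> give a diagonal entry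
  times the determinant; if both diagonal entries vanish, \<open>(-b, 1)\<close> forces
  \<open>b = 0\<close>. The converse completes the square.\<close>

lemma binary_form_nonneg_iff:
  fixes a b c :: real
  shows "(\<forall>y z. 0 \<le> a * y ^ 2 + 2 * b * y * z + c * z ^ 2) \<longleftrightarrow> 0 \<le> a \<and> 0 \<le> c \<and> b ^ 2 \<le> a * c"
proof (intro iffI conjI allI)
  assume nonneg: "\<forall>y z. 0 \<le> a * y ^ 2 + 2 * b * y * z + c * z ^ 2"
  show "0 \<le> a" using nonneg[rule_format, of 1 0] by simp
  show "0 \<le> c" using nonneg[rule_format, of 0 1] by simp
  have "0 \<le> a * (a * c - b ^ 2)"
    using nonneg[rule_format, of "-b" a] by (simp add: algebra_simps power2_eq_square)
  moreover have "0 \<le> c * (a * c - b ^ 2)"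
    using nonneg[rule_format, of c "-b"] by (simp add: algebra_simps power2_eq_square)
  moreover have "b = 0" if "a = 0" "c = 0"
    using nonneg[rule_format, of "-b" 1] that by (simp add: power2_eq_square mult_nonneg_nonneg)
      (metis mult_eq_0_iff not_real_square_gt_zero linorder_not_le order_antisym zero_le_square)
  ultimately show "b ^ 2 \<le> a * c"
    using \<open>0 \<le> a\<close> \<open>0 \<le> c\<close> by (cases "a = 0"; cases "c = 0") (auto simp: zero_le_mult_iff mult_le_0_iff)
next
  fix y z
  assume *: "0 \<le> a \<and> 0 \<le> c \<and> b ^ 2 \<le> a * c"
  show "0 \<le> a * y ^ 2 + 2 * b * y * z + c * z ^ 2"
  proof (cases "a = 0")
    case True
    then show ?thesis using * by simp
  next
    case False
    have "0 \<le> (a * y + b * z) ^ 2 + (a * c - b ^ 2) * z ^ 2" using * by simp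
    also have "\<dots> = a * (a * y ^ 2 + 2 * b * y * z + c * z ^ 2)"
      by (simp add: algebra_simps power2_eq_square)
    finally show ?thesis using False * by (simp add: zero_le_mult_iff)
  qed
qed

text \<open>
  The triple \<open>(a, b, c)\<close> stands for \<open>a Y\<^sup>2 + 2 b Y Z + c Z\<^sup>2\<close>, so that \<open>a c - b\<^sup>2\<close> is the
  determinant of its Gram matrix.
\<close>

definition psd_form :: "real poly \<Rightarrow> real poly \<Rightarrow> real poly \<Rightarrow> bool" where
  "psd_form a b c \<longleftrightarrow> (\<forall>x\<in>{0..1}. \<forall>y z.
     0 \<le> poly a x * y ^ 2 + 2 * poly b x * y * z + poly c x * z ^ 2)"

definition in_cone :: "nat \<Rightarrow> nat \<Rightarrow> real poly \<Rightarrow> real poly \<Rightarrow> real poly \<Rightarrow> bool" where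
  "in_cone d e a b c \<longleftrightarrow>
     psd_form a b c \<and> degree a \<le> d \<and> degree b \<le> (d + e) div 2 \<and> degree c \<le> e"

text \<open>If the determinant of the given form is nonzero, such a part is no scalar multiple of
  it, which rules out extremality.\<close>

definition has_rank_one_part :: "nat \<Rightarrow> nat \<Rightarrow> real poly \<Rightarrow> real poly \<Rightarrow> real poly \<Rightarrow> bool" where
  "has_rank_one_part d e a b c \<longleftrightarrow>
     (\<exists>a' b' c'. in_cone d e a' b' c' \<and> in_cone d e (a - a') (b - b') (c - c') \<and>
        a' * c' = b' ^ 2 \<and> \<not> (a' = 0 \<and> b' = 0 \<and> c' = 0))"

lemma psd_form_iff:
  "psd_form a b c \<longleftrightarrow>
     (\<forall>x\<in>{0..1}. 0 \<le> poly a x \<and> 0 \<le> poly c x \<and> 0 \<le> poly (a * c - b ^ 2) x)"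
  unfolding psd_form_def binary_form_nonneg_iff by simp

lemma psd_form_off_roots:
  assumes "g \<noteq> 0"
    and "\<And>x. x \<in> {0..1} \<Longrightarrow> poly g x \<noteq> 0 \<Longrightarrow>
      0 \<le> poly a x \<and> 0 \<le> poly c x \<and> 0 \<le> poly (a * c - b ^ 2) x"
  shows "psd_form a b c"
  unfolding psd_form_iff using poly_nonneg_off_roots[OF assms(1)] assms(2) by blast

text \<open>A vanishing diagonal entry leaves \<open>- b ^ 2\<close> as the determinant.\<close>

lemma psd_form_outer_eq_0:
  assumes "psd_form a b c" "x \<in> {0..1}" "poly a x = 0 \<or> poly c x = 0"
  shows "poly b x = 0"
proof -
  have "0 \<le> poly (a * c - b ^ 2) x" using assms by (simp add: psd_form_iff)
  then show ?thesis using assms(3) by auto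
qed

lemma psd_form_first_neq_0:
  assumes "psd_form a b c" "a * c \<noteq> b ^ 2"
  shows "a \<noteq> 0"
proof
  assume "a = 0"
  with assms(1) have "poly b x = 0" if "x \<in> {0..1}" for x
    using psd_form_outer_eq_0 that by simp
  then have "b = 0" by (rule poly_eq_0_if_zero_on_unit_interval)
  with \<open>a = 0\<close> assms(2) show False by simp
qed

section \<open>Exchange and shear of the two variables\<close>

lemma psd_form_swap: "psd_form a b c \<longleftrightarrow> psd_form c b a"
  unfolding psd_form_iff by (auto simp: mult.commute)

lemma in_cone_swap: "in_cone d e a b c \<longleftrightarrow> in_cone e d c b a"
  unfolding in_cone_def using psd_form_swap by (auto simp: add.commute)

lemma has_rank_one_part_swap:
  assumes "has_rank_one_part d e a b c"
  shows "has_rank_one_part e d c b a"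
proof -
  obtain a' b' c' where *: "in_cone d e a' b' c'" "in_cone d e (a - a') (b - b') (c - c')"
    "a' * c' = b' ^ 2" "\<not> (a' = 0 \<and> b' = 0 \<and> c' = 0)"
    using assms by (auto simp: has_rank_one_part_def)
  have "in_cone e d c' b' a'" "in_cone e d (c - c') (b - b') (a - a')"
    using *(1,2) in_cone_swap by blast+
  with *(3,4) show ?thesis
    unfolding has_rank_one_part_def by (metis mult.commute)
qed

lemma psd_form_shear:
  assumes "psd_form a b c"
  shows "psd_form (a + smult (2 * t) b + smult (t ^ 2) c) (b + smult t c) c"
  unfolding psd_form_def
proof (intro ballI allI)
  fix x y z :: real assume "x \<in> {0..1}"
  then have "0 \<le> poly a x * y ^ 2 + 2 * poly b x * y * (z + t * y) + poly c x * (z + t * y) ^ 2"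
    using assms by (simp add: psd_form_def)
  then show "0 \<le> poly (a + smult (2 * t) b + smult (t ^ 2) c) x * y ^ 2 +
      2 * poly (b + smult t c) x * y * z + poly c x * z ^ 2"
    by (simp add: algebra_simps power2_eq_square)
qed

text \<open>The shear adds multiples of \<open>b\<close> and \<open>c\<close> to \<open>a\<close>,
  and of \<open>c\<close> to \<open>b\<close>; these fit because \<open>e \<le> d\<close> gives
  \<open>e \<le> (d + e) div 2 \<le> d\<close>.\<close>

lemma in_cone_shear:
  assumes "in_cone d e a b c" "e \<le> d"
  shows "in_cone d e (a + smult (2 * t) b + smult (t ^ 2) c) (b + smult t c) c"
proof -
  have "degree b \<le> d" "degree c \<le> d" "degree c \<le> (d + e) div 2"
    using assms by (auto simp: in_cone_def)
  then show ?thesis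
    using assms psd_form_shear unfolding in_cone_def
    by (auto intro!: degree_add_le degree_smult_le[THEN order_trans])
qed

text \<open>The substitution of \<open>Z + t Y\<close> for \<open>Z\<close> has determinant
  one.\<close>

lemma shear_disc:
  fixes a b c :: "real poly"
  shows "(a + smult (2 * t) b + smult (t ^ 2) c) * c - (b + smult t c) ^ 2 = a * c - b ^ 2"
  by (rule poly_eq_poly_eq_iff[THEN iffD1]) (simp add: fun_eq_iff algebra_simps power2_eq_square)

text \<open>The part found after shearing is pulled back by the opposite shear.\<close>

lemma has_rank_one_part_shear:
  assumes "has_rank_one_part d e (a + smult (2 * t) b + smult (t ^ 2) c) (b + smult t c) c" "e \<le> d"
  shows "has_rank_one_part d e a b c"
proof -
  obtain a' b' c' where *: "in_cone d e a' b' c'"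
    "in_cone d e (a + smult (2 * t) b + smult (t ^ 2) c - a') (b + smult t c - b') (c - c')"
    "a' * c' = b' ^ 2" "\<not> (a' = 0 \<and> b' = 0 \<and> c' = 0)"
    using assms(1) by (auto simp: has_rank_one_part_def)
  define a1 b1 where "a1 = a' + smult (2 * (-t)) b' + smult ((-t) ^ 2) c'" and "b1 = b' + smult (-t) c'"
  have "in_cone d e a1 b1 c'"
    unfolding a1_def b1_def using *(1) assms(2) by (rule in_cone_shear)
  moreover have "in_cone d e (a - a1) (b - b1) (c - c')"
  proof -
    have eq_a: "a + smult (2 * t) b + smult (t ^ 2) c - a' + smult (2 * (-t)) (b + smult t c - b')
        + smult ((-t) ^ 2) (c - c') = a - a1"
      by (intro poly_eqI) (simp add: a1_def algebra_simps power2_eq_square)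
    have eq_b: "b + smult t c - b' + smult (-t) (c - c') = b - b1"
      by (intro poly_eqI) (simp add: b1_def algebra_simps)
    show ?thesis
      using in_cone_shear[OF *(2) assms(2), of "-t"] unfolding eq_a eq_b .
  qed
  moreover have "a1 * c' = b1 ^ 2"
    using shear_disc[of a' "-t" b' c'] *(3) unfolding a1_def b1_def by simp
  moreover have "\<not> (a1 = 0 \<and> b1 = 0 \<and> c' = 0)"
    using *(4) by (auto simp: a1_def b1_def)
  ultimately show ?thesis unfolding has_rank_one_part_def by blast
qed

text \<open>Substituting \<open>(X - t) Y\<close> for \<open>Y\<close> keeps nonnegativity, and
  \<open>(d - 2 + e) div 2 + 1 = (d + e) div 2\<close> matches the middle bound.\<close>

lemma in_cone_mult_Y:
  assumes "in_cone (d - 2) e a b c" "2 \<le> d"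
  shows "in_cone d e ([:-t, 1:] ^ 2 * a) ([:-t, 1:] * b) c"
proof -
  have "degree ([:-t, 1:] ^ 2 * a) \<le> 2 + degree a"
    by (rule order_trans[OF degree_mult_le]) (simp add: degree_power_eq)
  moreover have "degree ([:-t, 1:] * b) \<le> 1 + degree b"
    by (rule order_trans[OF degree_mult_le]) simp
  moreover have "psd_form ([:-t, 1:] ^ 2 * a) ([:-t, 1:] * b) c"
    unfolding psd_form_def
  proof (intro ballI allI)
    fix x y z :: real assume "x \<in> {0..1}"
    then have "0 \<le> poly a x * ((x - t) * y) ^ 2 + 2 * poly b x * ((x - t) * y) * z + poly c x * z ^ 2"
      using assms(1) unfolding in_cone_def psd_form_def by blast
    then show "0 \<le> poly ([:-t, 1:] ^ 2 * a) x * y ^ 2 + 2 * poly ([:-t, 1:] * b) x * y * z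
        + poly c x * z ^ 2"
      by (simp add: algebra_simps power2_eq_square)
  qed
  ultimately show ?thesis using assms unfolding in_cone_def by auto
qed

lemma in_cone_mult_common:
  assumes "in_cone (d - 1) (e - 1) a b c" "1 \<le> d" "1 \<le> e" "degree l = 1"
    and "\<And>x. x \<in> {0..1} \<Longrightarrow> 0 \<le> poly l x"
  shows "in_cone d e (l * a) (l * b) (l * c)"
proof -
  have "degree (l * f) \<le> 1 + degree f" for f
    using degree_mult_le[of l f] assms(4) by simp
  moreover have "psd_form (l * a) (l * b) (l * c)"
    unfolding psd_form_def
  proof (intro ballI allI)
    fix x y z :: real assume "x \<in> {0..1}"
    then have "0 \<le> poly l x * (poly a x * y ^ 2 + 2 * poly b x * y * z + poly c x * z ^ 2)"
      using assms(1,5) unfolding in_cone_def psd_form_def by (intro mult_nonneg_nonneg) auto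
    then show "0 \<le> poly (l * a) x * y ^ 2 + 2 * poly (l * b) x * y * z + poly (l * c) x * z ^ 2"
      by (simp add: algebra_simps)
  qed
  ultimately show ?thesis
    using assms(1,2,3) order_trans[of "degree (l * a)" "1 + degree a" d]
      order_trans[of "degree (l * b)" "1 + degree b" "(d + e) div 2"]
      order_trans[of "degree (l * c)" "1 + degree c" e]
    unfolding in_cone_def by auto
qed

subsection \<open>Forms with nonzero determinant\<close>

text \<open>A double root of \<open>a\<close> is a root of \<open>b\<close>, so the form arises from
  a smaller one by substituting \<open>(X - t) Y\<close> for \<open>Y\<close>. The smaller form is
  nonnegative at \<open>t\<close> by continuity, and its rank-one part lifts back.\<close>

lemma has_rank_one_part_divide_Y:
  assumes IH: "\<And>d' e' a b c. d' + e' < d + e \<Longrightarrow> in_cone d' e' a b c \<Longrightarrow> a * c \<noteq> b ^ 2 \<Longrightarrow>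
      has_rank_one_part d' e' a b c"
    and cone: "in_cone d e a b c" and disc: "a * c \<noteq> b ^ 2"
    and t: "t \<in> {0..1}" "[:-t, 1:] ^ 2 dvd a"
  shows "has_rank_one_part d e a b c"
proof -
  define l where "l = [:-t, 1:]"
  have l: "l \<noteq> 0" "degree l = 1" by (auto simp: l_def)
  obtain a1 where a: "a = l ^ 2 * a1" using t(2) unfolding l_def by blast
  have "poly a t = 0" by (simp add: a l_def)
  then have "poly b t = 0"
    using psd_form_outer_eq_0 cone t(1) unfolding in_cone_def by blast
  then obtain b1 where b: "b = l * b1" by (auto simp: poly_eq_0_iff_dvd l_def)
  \<comment> \<open>Nonvanishing makes the degrees add exactly, so that \<open>d - 2\<close> does
    not truncate.\<close>
  have "a \<noteq> 0" using psd_form_first_neq_0 cone disc unfolding in_cone_def by blast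
  then have "a1 \<noteq> 0" by (auto simp: a)
  then have "degree a = 2 + degree a1"
    using l by (simp add: a degree_mult_eq degree_power_eq)
  then have d: "2 \<le> d" "degree a1 \<le> d - 2" using cone by (auto simp: in_cone_def)
  have "degree b1 \<le> (d - 2 + e) div 2"
  proof (cases "b1 = 0")
    case False
    then have "degree b = 1 + degree b1" using l by (simp add: b degree_mult_eq)
    then have "1 + degree b1 \<le> (d + e) div 2" using cone by (simp add: in_cone_def)
    then show ?thesis using d(1) by arith
  qed simp
  moreover have "psd_form a1 b1 c"
  proof (rule psd_form_off_roots[OF l(1)])
    fix x :: real assume x: "x \<in> {0..1}" "poly l x \<noteq> 0"
    then have "0 \<le> poly l x ^ 2 * poly a1 x" "0 \<le> poly c x"
      "0 \<le> poly l x ^ 2 * poly (a1 * c - b1 ^ 2) x"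
      using cone by (auto simp: in_cone_def psd_form_iff a b algebra_simps power_mult_distrib)
    with x show "0 \<le> poly a1 x \<and> 0 \<le> poly c x \<and> 0 \<le> poly (a1 * c - b1 ^ 2) x"
      by (simp add: zero_le_mult_iff)
  qed
  ultimately have "in_cone (d - 2) e a1 b1 c" using d cone by (simp add: in_cone_def)
  moreover have "a1 * c \<noteq> b1 ^ 2" using disc by (auto simp: a b power_mult_distrib mult.assoc)
  ultimately have "has_rank_one_part (d - 2) e a1 b1 c" using IH d(1) by simp
  then obtain a' b' c' where *: "in_cone (d - 2) e a' b' c'"
    "in_cone (d - 2) e (a1 - a') (b1 - b') (c - c')"
    "a' * c' = b' ^ 2" "\<not> (a' = 0 \<and> b' = 0 \<and> c' = 0)"
    by (auto simp: has_rank_one_part_def)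
  have "in_cone d e (l ^ 2 * a') (l * b') c'"
    using in_cone_mult_Y[OF *(1) d(1)] by (simp add: l_def)
  moreover have "in_cone d e (a - l ^ 2 * a') (b - l * b') (c - c')"
    using in_cone_mult_Y[OF *(2) d(1), of t] by (simp add: a b l_def[symmetric] right_diff_distrib)
  moreover have "(l ^ 2 * a') * c' = (l * b') ^ 2"
    using *(3) by (simp add: power_mult_distrib mult.assoc)
  moreover have "\<not> (l ^ 2 * a' = 0 \<and> l * b' = 0 \<and> c' = 0)"
    using *(4) l(1) by auto
  ultimately show ?thesis unfolding has_rank_one_part_def by blast
qed

text \<open>Dividing by \<open>l\<close> lowers both degree bounds by one; a rank-one part of the
  quotient is multiplied by \<open>l\<close> again.\<close>

lemma has_rank_one_part_divide_common:
  assumes IH: "\<And>d' e' a b c. d' + e' < d + e \<Longrightarrow> in_cone d' e' a b c \<Longrightarrow> a * c \<noteq> b ^ 2 \<Longrightarrow>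
      has_rank_one_part d' e' a b c"
    and cone: "in_cone d e (l * a) (l * b) (l * c)" and disc: "a * c \<noteq> b ^ 2"
    and l: "degree l = 1" "\<And>x. x \<in> {0..1} \<Longrightarrow> 0 \<le> poly l x"
  shows "has_rank_one_part d e (l * a) (l * b) (l * c)"
proof -
  have "l \<noteq> 0" using l by auto
  have deg: "degree (l * f) = 1 + degree f" if "f \<noteq> 0" for f
    using that \<open>l \<noteq> 0\<close> l(1) by (simp add: degree_mult_eq)
  have psd: "psd_form a b c"
  proof (rule psd_form_off_roots[OF \<open>l \<noteq> 0\<close>])
    fix x :: real assume x: "x \<in> {0..1}" "poly l x \<noteq> 0"
    then have "0 < poly l x" using l(2)[of x] by simp
    moreover have "0 \<le> poly l x * poly a x" "0 \<le> poly l x * poly c x"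
      "0 \<le> poly l x ^ 2 * poly (a * c - b ^ 2) x"
      using cone x by (auto simp: in_cone_def psd_form_iff algebra_simps power2_eq_square)
    ultimately show "0 \<le> poly a x \<and> 0 \<le> poly c x \<and> 0 \<le> poly (a * c - b ^ 2) x"
      by (simp add: zero_le_mult_iff)
  qed
  then have "a \<noteq> 0" "c \<noteq> 0"
    using psd_form_first_neq_0[of a b c] psd_form_first_neq_0[of c b a] psd_form_swap[of a b c] disc
    by (auto simp: mult.commute)
  then have de: "1 \<le> d" "1 \<le> e" "degree a \<le> d - 1" "degree c \<le> e - 1"
    using cone deg by (auto simp: in_cone_def)
  moreover have "degree b \<le> (d - 1 + (e - 1)) div 2"
    using cone deg[of b] de by (cases "b = 0") (auto simp: in_cone_def)
  ultimately have "in_cone (d - 1) (e - 1) a b c" using psd by (simp add: in_cone_def)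
  then have "has_rank_one_part (d - 1) (e - 1) a b c" using IH de disc by simp
  then obtain a' b' c' where *: "in_cone (d - 1) (e - 1) a' b' c'"
    "in_cone (d - 1) (e - 1) (a - a') (b - b') (c - c')"
    "a' * c' = b' ^ 2" "\<not> (a' = 0 \<and> b' = 0 \<and> c' = 0)"
    by (auto simp: has_rank_one_part_def)
  have "in_cone d e (l * a') (l * b') (l * c')"
    using *(1) de(1,2) l by (rule in_cone_mult_common)
  moreover have "in_cone d e (l * a - l * a') (l * b - l * b') (l * c - l * c')"
    using in_cone_mult_common[OF *(2) de(1,2) l] by (simp add: right_diff_distrib)
  moreover have "(l * a') * (l * c') = (l * b') ^ 2"
    using *(3) by (simp add: power2_eq_square mult_ac)
  moreover have "\<not> (l * a' = 0 \<and> l * b' = 0 \<and> l * c' = 0)"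
    using *(4) \<open>l \<noteq> 0\<close> by auto
  ultimately show ?thesis unfolding has_rank_one_part_def by blast
qed

text \<open>A double root of \<open>a\<close> would allow a reduction in \<open>Y\<close>; interior
  roots are double by nonnegativity. At an endpoint, a double root of the determinant would force
  \<open>c\<close> to vanish too, giving all three entries a common factor. Both contradict
  \<open>no_part\<close>.\<close>

lemma disc_root_simple_if_first_root:
  assumes IH: "\<And>d' e' a b c. d' + e' < d + e \<Longrightarrow> in_cone d' e' a b c \<Longrightarrow> a * c \<noteq> b ^ 2 \<Longrightarrow>
      has_rank_one_part d' e' a b c"
    and cone: "in_cone d e a b c" and disc: "a * c \<noteq> b ^ 2"
    and no_part: "\<not> has_rank_one_part d e a b c"
    and t: "t \<in> {0..1}" "poly a t = 0"
  shows "t \<in> {0, 1} \<and> \<not> [:-t, 1:] ^ 2 dvd a * c - b ^ 2"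
proof -
  have no_dvd: "\<not> [:-t, 1:] ^ 2 dvd a"
    using has_rank_one_part_divide_Y[OF IH cone disc t(1)] no_part by blast
  have "t = 0 \<or> t = 1"
  proof (rule ccontr)
    assume "\<not> ?thesis"
    then have "[:-t, 1:] ^ 2 dvd a"
      using t cone by (intro linear_power2_dvd_if_nonneg) (auto simp: in_cone_def psd_form_iff)
    with no_dvd show False ..
  qed
  \<comment> \<open>\<open>s\<close> is \<open>1\<close> for \<open>t = 0\<close> and
    \<open>-1\<close> for \<open>t = 1\<close>, so that \<open>s (X - t)\<close> is nonnegative on
    the interval.\<close>
  then obtain s :: real where s: "s \<noteq> 0" "\<And>x. x \<in> {0..1} \<Longrightarrow> 0 \<le> s * (x - t)"
    by (elim disjE) (rule that[of 1] that[of "-1"], auto)+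
  define l where "l = smult s [:-t, 1:]"
  have l: "degree l = 1" "\<And>x. x \<in> {0..1} \<Longrightarrow> 0 \<le> poly l x" and root: "poly l t = 0"
    using s by (auto simp: l_def algebra_simps)
  have dvd_iff: "l dvd f \<longleftrightarrow> poly f t = 0" for f
    unfolding l_def using s(1) by (simp add: smult_dvd_iff poly_eq_0_iff_dvd del: smult_pCons)
  have "poly b t = 0" using psd_form_outer_eq_0 cone t unfolding in_cone_def by blast
  then obtain a1 b1 where ab: "a = l * a1" "b = l * b1"
    using t(2) dvd_iff by (meson dvdE)
  have "\<not> [:-t, 1:] ^ 2 dvd a * c - b ^ 2"
  proof
    assume "[:-t, 1:] ^ 2 dvd a * c - b ^ 2"
    then have "l ^ 2 dvd a * c - b ^ 2"
      using s(1) by (simp only: l_def smult_power smult_dvd_iff) simp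
    \<comment> \<open>After one factor \<open>l\<close> cancels, the second term still vanishes at
      \<open>t\<close>, which leaves \<open>a1 c = 0\<close> there.\<close>
    moreover have "a * c - b ^ 2 = l * (a1 * c - l * b1 ^ 2)"
      by (simp add: ab algebra_simps power2_eq_square)
    moreover have "l \<noteq> 0" using l(1) by auto
    ultimately have "l dvd a1 * c - l * b1 ^ 2" by (simp add: power2_eq_square)
    then have "poly a1 t * poly c t = 0" using root by (simp add: dvd_iff)
    moreover have "poly a1 t \<noteq> 0"
    proof
      assume "poly a1 t = 0"
      then have "[:-t, 1:] * [:-t, 1:] dvd l * a1"
        using s(1) dvd_iff[of a1] root by (intro mult_dvd_mono) (auto simp: poly_eq_0_iff_dvd)
      with no_dvd show False by (simp add: ab power2_eq_square)
    qed
    ultimately have "l dvd c" by (simp add: dvd_iff)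
    then obtain c1 where c: "c = l * c1" by blast
    have "a1 * c1 \<noteq> b1 ^ 2"
    proof
      assume eq: "a1 * c1 = b1 ^ 2"
      have "a * c = l ^ 2 * (a1 * c1)" by (simp add: ab c power2_eq_square mult_ac)
      also have "\<dots> = b ^ 2" by (simp add: eq ab power_mult_distrib)
      finally show False using disc by simp
    qed
    then have "has_rank_one_part d e a b c"
      using has_rank_one_part_divide_common[OF IH _ _ l, where a = a1 and b = b1 and c = c1] cone by (simp add: ab c)
    with no_part show False ..
  qed
  with \<open>t = 0 \<or> t = 1\<close> show ?thesis by simp
qed

section \<open>Rank-one forms below a given form\<close>

lemma psd_form_rank_one:
  assumes "\<And>x. x \<in> {0..1} \<Longrightarrow> 0 \<le> poly r x"
  shows "psd_form (r * p ^ 2) (r * p * q) (r * q ^ 2)"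
  unfolding psd_form_iff using assms by (auto simp: power2_eq_square)

text \<open>
  \<open>r (a q\<^sup>2 - 2 b p q + c p\<^sup>2)\<close> is \<open>r\<close> times the value of the form at the kernel vector \<open>(q, -p)\<close> of
  \<open>p Y + q Z\<close>; by Cauchy--Schwarz its quotient by the determinant bounds \<open>r (p Y + q Z)\<^sup>2\<close> relative
  to the form.
\<close>

lemma has_rank_one_part_if_kernel_value_dominated:
  assumes cone: "in_cone d e a b c" and disc: "a * c \<noteq> b ^ 2"
    and r: "\<And>x. x \<in> {0..1} \<Longrightarrow> 0 \<le> poly r x" "r \<noteq> 0" and pq: "\<not> (p = 0 \<and> q = 0)"
    and deg: "degree (r * p ^ 2) \<le> d" "degree (r * p * q) \<le> (d + e) div 2" "degree (r * q ^ 2) \<le> e"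
    and C: "C > 0" "\<And>x. x \<in> {0..1} \<Longrightarrow>
      poly (r * (a * q ^ 2 - 2 * b * p * q + c * p ^ 2)) x \<le> C * poly (a * c - b ^ 2) x"
  shows "has_rank_one_part d e a b c"
proof -
  define s where "s = smult (1 / C) r"
  have s: "\<And>x. x \<in> {0..1} \<Longrightarrow> 0 \<le> poly s x" "s \<noteq> 0" using r C(1) by (auto simp: s_def)
  have deg_s: "degree (s * p ^ 2) \<le> d" "degree (s * p * q) \<le> (d + e) div 2" "degree (s * q ^ 2) \<le> e"
    using deg C(1) by (simp_all add: s_def)
  then have "in_cone d e (s * p ^ 2) (s * p * q) (s * q ^ 2)"
    using psd_form_rank_one s(1) by (simp add: in_cone_def)
  moreover have "psd_form (a - s * p ^ 2) (b - s * p * q) (c - s * q ^ 2)"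
    unfolding psd_form_def
  proof (intro ballI allI)
    fix x y z :: real assume x: "x \<in> {0..1}"
    \<comment> \<open>Fixing \<open>y\<close> and \<open>z\<close> turns the difference into a
      polynomial in \<open>X\<close>, so the zeros of the determinant can be filled in by
      continuity.\<close>
    define f where "f = smult (y ^ 2) (a - s * p ^ 2) + smult (2 * y * z) (b - s * p * q) + smult (z ^ 2) (c - s * q ^ 2)"
    have "0 \<le> poly f x"
    proof (rule poly_nonneg_off_roots)
      show "a * c - b ^ 2 \<noteq> 0" using disc by simp
      fix x :: real assume x: "x \<in> {0..1}" "poly (a * c - b ^ 2) x \<noteq> 0"
      define A B D P Q R where "A = poly a x" "B = poly b x" "D = poly c x"
        "P = poly p x" "Q = poly q x" "R = poly r x"
      note defs = this
      define \<Delta> where "\<Delta> = A * D - B ^ 2"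
      have "0 < \<Delta>" using x cone by (auto simp: \<Delta>_def defs in_cone_def psd_form_iff less_le)
      define v where "v = A * y ^ 2 + 2 * B * y * z + D * z ^ 2"
      have "0 \<le> v" using cone x by (auto simp: v_def defs in_cone_def psd_form_def)
      have "0 \<le> R" using r x by (simp add: defs)
      have kernel: "R * (A * Q ^ 2 - 2 * B * P * Q + D * P ^ 2) \<le> C * \<Delta>"
        using C(2)[OF x(1)] by (simp add: \<Delta>_def defs)
      \<comment> \<open>Gram identity for \<open>(y, z)\<close> and \<open>(Q, -P)\<close>: the
        product of their form values is their squared pairing plus the determinant times a squared
        area.\<close>
      have "\<Delta> * (P * y + Q * z) ^ 2 + (A * y * Q + B * (z * Q - y * P) - D * z * P) ^ 2
          = v * (A * Q ^ 2 - 2 * B * P * Q + D * P ^ 2)"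
        by (simp add: v_def \<Delta>_def algebra_simps power2_eq_square)
      then have "\<Delta> * (P * y + Q * z) ^ 2 \<le> v * (A * Q ^ 2 - 2 * B * P * Q + D * P ^ 2)"
        using zero_le_power2[of "A * y * Q + B * (z * Q - y * P) - D * z * P"] by linarith
      then have "R * (\<Delta> * (P * y + Q * z) ^ 2) \<le> R * (v * (A * Q ^ 2 - 2 * B * P * Q + D * P ^ 2))"
        using \<open>0 \<le> R\<close> by (rule mult_left_mono)
      also have "\<dots> \<le> v * (C * \<Delta>)"
        using mult_left_mono[OF kernel \<open>0 \<le> v\<close>] by (simp add: mult.left_commute)
      finally have "\<Delta> * (R * (P * y + Q * z) ^ 2) \<le> \<Delta> * (C * v)" by (simp add: mult_ac)
      then have "R * (P * y + Q * z) ^ 2 \<le> C * v" using \<open>0 < \<Delta>\<close> by simp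
      then have "(R / C) * (P * y + Q * z) ^ 2 \<le> v" using C(1) by (simp add: field_simps)
      moreover have "poly f x = v - (R / C) * (P * y + Q * z) ^ 2"
        using C(1) by (simp add: f_def s_def v_def defs field_simps power2_eq_square)
      ultimately show "0 \<le> poly f x" by simp
    qed (rule x)
    then show "0 \<le> poly (a - s * p ^ 2) x * y ^ 2 + 2 * poly (b - s * p * q) x * y * z
        + poly (c - s * q ^ 2) x * z ^ 2"
      by (simp add: f_def mult_ac)
  qed
  then have "in_cone d e (a - s * p ^ 2) (b - s * p * q) (c - s * q ^ 2)"
    using cone deg_s by (auto simp: in_cone_def intro: degree_diff_le)
  moreover have "(s * p ^ 2) * (s * q ^ 2) = (s * p * q) ^ 2"
    by (simp add: power2_eq_square mult_ac)
  moreover have "\<not> (s * p ^ 2 = 0 \<and> s * p * q = 0 \<and> s * q ^ 2 = 0)"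
    using s(2) pq by auto
  ultimately show ?thesis unfolding has_rank_one_part_def by blast
qed

text \<open>\<open>(q, -p)\<close> is a kernel vector of the Gram matrix: \<open>(b, -a)\<close>, or
  \<open>(1, 0)\<close> if the first row vanishes.\<close>

lemma binary_form_kernel_vector:
  fixes a b c :: real
  assumes "a * c = b ^ 2"
  obtains p q where "\<not> (p = 0 \<and> q = 0)" "a * q ^ 2 - 2 * b * p * q + c * p ^ 2 = 0"
proof (cases "a = 0 \<and> b = 0")
  case True
  then show ?thesis using that[of 0 1] by simp
next
  case False
  have "a * b ^ 2 - 2 * b * a * b + c * a ^ 2 = a * (a * c - b ^ 2)"
    by (simp add: algebra_simps power2_eq_square)
  then show ?thesis using that[of a b] False assms by simp
qed

lemma has_rank_one_part_if_simple_boundary_roots: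
  assumes cone: "in_cone d e a b c" and disc: "a * c \<noteq> b ^ 2" and "e \<le> d"
    and roots: "\<And>x. x \<in> {0..1} \<Longrightarrow> poly (a * c - b ^ 2) x = 0 \<Longrightarrow>
      x \<in> {0, 1} \<and> \<not> [:-x, 1:] ^ 2 dvd a * c - b ^ 2"
  shows "has_rank_one_part d e a b c"
proof (cases "e = 0")
  case True
  then obtain k where c: "c = [:k:]" using cone by (auto simp: in_cone_def elim: degree_eq_zeroE)
  have "psd_form c b a" using cone psd_form_swap in_cone_def by blast
  then have "c \<noteq> 0" using psd_form_first_neq_0[of c b a] disc by (simp add: mult.commute)
  moreover have "0 \<le> poly c x" if "x \<in> {0..1}" for x
    using cone that by (simp add: in_cone_def psd_form_iff)
  from this[of 0] have "0 \<le> k" by (simp add: c)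
  ultimately have k: "0 < k" using c by (simp add: less_le)
  \<comment> \<open>Completing the square in \<open>Z\<close> splits off
    \<open>(b Y + c Z) ^ 2 / k\<close>; its kernel value is exactly \<open>k\<close> times the
    determinant.\<close>
  show ?thesis
  proof (rule has_rank_one_part_if_kernel_value_dominated[OF cone disc, of 1 b c k])
    have deg_b: "2 * degree b \<le> d" "degree b \<le> d div 2"
      using cone True by (auto simp: in_cone_def)
    show "degree (1 * b ^ 2) \<le> d"
      using deg_b degree_power_le[of b 2] by simp
    show "degree (1 * b * c) \<le> (d + e) div 2" "degree (1 * c ^ 2) \<le> e"
      using deg_b by (simp_all add: c True power2_eq_square mult_pCons_left)
    show "poly (1 * (a * c ^ 2 - 2 * b * b * c + c * b ^ 2)) x \<le> k * poly (a * c - b ^ 2) x" for x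
      by (simp add: c algebra_simps power2_eq_square)
  qed (use \<open>c \<noteq> 0\<close> k in auto)
next
  case False
  then have de: "1 \<le> e" "1 \<le> d" "1 \<le> (d + e) div 2" using \<open>e \<le> d\<close> by auto
  \<comment> \<open>The factor \<open>X\<close> makes the part vanish at \<open>0\<close> if the
    determinant does; degree one fits since \<open>1 \<le> e \<le> d\<close>.\<close>
  define r :: "real poly" where "r = (if poly (a * c - b ^ 2) 0 = 0 then [:0, 1:] else 1)"
  have r: "degree r \<le> 1" "r \<noteq> 0" "\<And>x. x \<in> {0..1} \<Longrightarrow> 0 \<le> poly r x"
    by (auto simp: r_def)
  \<comment> \<open>At \<open>1\<close> the constants \<open>P\<close> and \<open>Q\<close> supply
    the kernel vector; any nonzero pair serves if the determinant is nonzero there.\<close>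
  obtain P Q :: real where PQ: "\<not> (P = 0 \<and> Q = 0)"
    "poly (a * c - b ^ 2) 1 = 0 \<Longrightarrow> poly a 1 * Q ^ 2 - 2 * poly b 1 * P * Q + poly c 1 * P ^ 2 = 0"
  proof (cases "poly (a * c - b ^ 2) 1 = 0")
    case True
    then have "poly a 1 * poly c 1 = poly b 1 ^ 2" by simp
    then show ?thesis using binary_form_kernel_vector that by metis
  next
    case False
    then show ?thesis using that[of 1 0] by simp
  qed
  define g where "g = r * (a * [:Q:] ^ 2 - 2 * b * [:P:] * [:Q:] + c * [:P:] ^ 2)"
  have g_root: "poly g x = 0" if "x \<in> {0..1}" "poly (a * c - b ^ 2) x = 0" for x
  proof -
    have "x = 0 \<or> x = 1" using roots[OF that] by simp
    then show ?thesis
    proof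
      assume "x = 0"
      then show ?thesis using that(2) by (simp add: g_def r_def)
    next
      assume "x = 1"
      then have "poly g x =
          poly r 1 * (poly a 1 * Q ^ 2 - 2 * poly b 1 * P * Q + poly c 1 * P ^ 2)"
        by (simp add: g_def algebra_simps)
      with \<open>x = 1\<close> PQ(2) that(2) show ?thesis by (simp only: mult_zero_right)
    qed
  qed
  obtain C where C: "C > 0" "\<And>x. x \<in> {0..1} \<Longrightarrow> \<bar>poly g x\<bar> \<le> C * \<bar>poly (a * c - b ^ 2) x\<bar>"
    using abs_poly_bounded_by_multiple[of "a * c - b ^ 2" g] disc roots g_root by auto
  have bound: "poly g x \<le> C * poly (a * c - b ^ 2) x" if "x \<in> {0..1}" for x
  proof -
    have "0 \<le> poly (a * c - b ^ 2) x" using cone that unfolding in_cone_def psd_form_iff by blast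
    then have "\<bar>poly g x\<bar> \<le> C * poly (a * c - b ^ 2) x" using C(2)[OF that] by (simp only: abs_of_nonneg)
    then show ?thesis by linarith
  qed
  have const: "degree (r * [:u:] * [:v:]) \<le> 1" for u v
    using r(1) degree_smult_le[of u r] degree_smult_le[of v "smult u r"] by simp
  show ?thesis
  proof (rule has_rank_one_part_if_kernel_value_dominated[OF cone disc r(3,2) _ _ _ _ C(1) bound[unfolded g_def]])
    show "degree (r * [:P:] ^ 2) \<le> d" "degree (r * [:P:] * [:Q:]) \<le> (d + e) div 2"
      "degree (r * [:Q:] ^ 2) \<le> e"
      using const[of P P] const[of P Q] const[of Q Q] de
      unfolding power2_eq_square mult.assoc[symmetric] by linarith+
  qed (use PQ(1) in auto)
qed

lemma has_rank_one_part_if_disc_neq_0: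
  assumes "in_cone d e a b c" "a * c \<noteq> b ^ 2"
  shows "has_rank_one_part d e a b c"
  using assms
proof (induction "d + e" arbitrary: d e a b c rule: less_induct)
  case less
  \<comment> \<open>Stated for arbitrary \<open>d\<close> and \<open>e\<close> with the induction
    hypothesis as a premise, so that it also applies after exchanging them.\<close>
  have le_case: "has_rank_one_part d e a b c"
    if IH: "\<And>d' e' a b c. d' + e' < d + e \<Longrightarrow> in_cone d' e' a b c \<Longrightarrow> a * c \<noteq> b ^ 2 \<Longrightarrow>
        has_rank_one_part d' e' a b c"
      and cone: "in_cone d e a b c" and disc: "a * c \<noteq> b ^ 2" and "e \<le> d"
    for d e a b c
  proof (rule ccontr)
    assume no_part: "\<not> has_rank_one_part d e a b c"
    have "x \<in> {0, 1} \<and> \<not> [:-x, 1:] ^ 2 dvd a * c - b ^ 2"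
      if x: "x \<in> {0..1}" "poly (a * c - b ^ 2) x = 0" for x
    proof (cases "poly c x = 0")
      case True
      have "in_cone e d c b a" using cone in_cone_swap by blast
      moreover have "c * a \<noteq> b ^ 2" using disc by (simp add: mult.commute)
      moreover have "\<not> has_rank_one_part e d c b a" using no_part has_rank_one_part_swap by blast
      ultimately have "x \<in> {0, 1} \<and> \<not> [:-x, 1:] ^ 2 dvd c * a - b ^ 2"
        using True x(1) IH by (intro disc_root_simple_if_first_root[of e d]) (auto simp: add.commute)
      then show ?thesis by (simp add: mult.commute)
    next
      case False
      \<comment> \<open>This shear makes the middle coefficient vanish at \<open>x\<close>; as the
        determinant is zero there and \<open>c\<close> is not, the first coefficient vanishes
        too.\<close>
      define t where "t = - poly b x / poly c x"
      define a1 b1 where "a1 = a + smult (2 * t) b + smult (t ^ 2) c" and "b1 = b + smult t c"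
      have disc_eq: "a1 * c - b1 ^ 2 = a * c - b ^ 2"
        unfolding a1_def b1_def by (rule shear_disc)
      have "poly b1 x = 0" using False by (simp add: b1_def t_def)
      moreover have "poly (a1 * c - b1 ^ 2) x = 0" using x(2) by (simp only: disc_eq)
      ultimately have "poly a1 x = 0" using False by simp
      moreover have "in_cone d e a1 b1 c"
        unfolding a1_def b1_def using cone \<open>e \<le> d\<close> by (rule in_cone_shear)
      moreover have "a1 * c \<noteq> b1 ^ 2" using disc disc_eq by auto
      moreover have "\<not> has_rank_one_part d e a1 b1 c"
        using no_part has_rank_one_part_shear \<open>e \<le> d\<close> unfolding a1_def b1_def by blast
      ultimately have "x \<in> {0, 1} \<and> \<not> [:-x, 1:] ^ 2 dvd a1 * c - b1 ^ 2"
        using x(1) IH by (intro disc_root_simple_if_first_root[of d e]) auto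
      then show ?thesis unfolding disc_eq .
    qed
    with has_rank_one_part_if_simple_boundary_roots[OF cone disc \<open>e \<le> d\<close>] no_part
    show False by blast
  qed
  show ?case
  proof (cases "e \<le> d")
    case True
    then show ?thesis using le_case less by blast
  next
    case False
    have "has_rank_one_part e d c b a"
    proof (rule le_case)
      show "has_rank_one_part d' e' a' b' c'"
        if "d' + e' < e + d" "in_cone d' e' a' b' c'" "a' * c' \<noteq> b' ^ 2" for d' e' a' b' c'
        using that less.hyps by (simp add: add.commute)
      show "in_cone e d c b a" using less.prems(1) in_cone_swap by blast
      show "c * a \<noteq> b ^ 2" using less.prems(2) by (simp add: mult.commute)
    qed (use False in simp)
    then show ?thesis by (rule has_rank_one_part_swap)
  qed
qed

subsection \<open>Extreme rays\<close>

text \<open>The outer list runs over powers of \<open>Z\<close>, the inner ones over powers of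
  \<open>Y\<close>; doubling \<open>b\<close> makes the triple the Gram matrix.\<close>

definition form3 :: "real poly \<Rightarrow> real poly \<Rightarrow> real poly \<Rightarrow> poly3" where
  "form3 a b c = [:[:0, 0, a:], [:0, smult 2 b:], [:c:]:]"

lemma form3_inject [simp]: "form3 a b c = form3 a' b' c' \<longleftrightarrow> a = a' \<and> b = b' \<and> c = c'"
  by (auto simp: form3_def dest: arg_cong[of _ _ "smult (1 / 2)"])

lemma form3_eq_0_iff: "form3 a b c = 0 \<longleftrightarrow> a = 0 \<and> b = 0 \<and> c = 0"
  by (auto simp: form3_def)

lemma form3_add: "form3 a b c + form3 a' b' c' = form3 (a + a') (b + b') (c + c')"
  by (simp add: form3_def smult_add_right)

lemma scale3_form3: "scale3 k (form3 a b c) = form3 (smult k a) (smult k b) (smult k c)"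
  by (simp add: form3_def scale3_def of_X_def mult_pCons_left mult.commute)

lemma form3_eq_monomials:
  "of_X f2 * var_Y ^ 2 + of_X f1 * var_Y * var_Z + of_X f0 * var_Z ^ 2 = form3 f2 (smult (1 / 2) f1) f0"
  by (simp add: form3_def of_X_def var_Y_def var_Z_def power2_eq_square mult_pCons_left)

lemma form3_square:
  "of_X r * (of_X p * var_Y + of_X q * var_Z) ^ 2 = form3 (r * p ^ 2) (r * p * q) (r * q ^ 2)"
  by (simp add: form3_def of_X_def var_Y_def var_Z_def power2_eq_square mult_pCons_left
      algebra_simps numeral_poly)

lemma eval3_form3:
  "eval3 (form3 a b c) (x, y, z) = poly a x * y ^ 2 + 2 * poly b x * y * z + poly c x * z ^ 2"
  by (simp add: eval3_def form3_def algebra_simps power2_eq_square)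

text \<open>Excluding \<open>(0, 0)\<close> from \<open>strip\<close> costs nothing, as every form
  vanishes there; halving the middle coefficient keeps its degree.\<close>

lemma form3_mem_cone_C: "form3 a b c \<in> cone_C d e \<longleftrightarrow> in_cone d e a b c"
proof -
  have "(\<forall>v\<in>strip. 0 \<le> eval3 (form3 a b c) v) \<longleftrightarrow> psd_form a b c"
  proof
    assume *: "\<forall>v\<in>strip. 0 \<le> eval3 (form3 a b c) v"
    have "0 \<le> poly a x * y ^ 2 + 2 * poly b x * y * z + poly c x * z ^ 2"
      if "x \<in> {0..1}" for x y z
      using *[rule_format, of "(x, y, z)"] that
      by (cases "y = 0 \<and> z = 0") (auto simp: strip_def eval3_form3)
    then show "psd_form a b c" by (simp add: psd_form_def)
  qed (auto simp: psd_form_def strip_def eval3_form3)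
  moreover have "(\<exists>f2 f1 f0. form3 a b c = form3 f2 (smult (1 / 2) f1) f0 \<and>
      degree f2 \<le> d \<and> degree f1 \<le> (d + e) div 2 \<and> degree f0 \<le> e) \<longleftrightarrow>
      degree a \<le> d \<and> degree b \<le> (d + e) div 2 \<and> degree c \<le> e"
    by (auto intro!: exI[of _ "smult 2 b"])
  ultimately show ?thesis unfolding cone_C_def form3_eq_monomials in_cone_def by blast
qed

lemma cone_C_cases:
  assumes "F \<in> cone_C d e"
  obtains a b c where "F = form3 a b c" "in_cone d e a b c"
proof -
  obtain f2 f1 f0 where "F = form3 f2 (smult (1 / 2) f1) f0"
    using assms unfolding cone_C_def form3_eq_monomials by blast
  with assms show thesis using that form3_mem_cone_C by blast
qed

text \<open>One summand suffices: the other is the difference, and exchanging the summands gives its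
  proportionality.\<close>

lemma generates_extreme_ray_form3:
  "generates_extreme_ray (cone_C d e) (form3 a b c) \<longleftrightarrow>
     in_cone d e a b c \<and> \<not> (a = 0 \<and> b = 0 \<and> c = 0) \<and>
     (\<forall>a' b' c'. in_cone d e a' b' c' \<longrightarrow> in_cone d e (a - a') (b - b') (c - c') \<longrightarrow>
        (\<exists>k. a' = smult k a \<and> b' = smult k b \<and> c' = smult k c))"
  (is "?L \<longleftrightarrow> ?R")
proof
  assume ?L
  show ?R
  proof (intro conjI allI impI)
    show "in_cone d e a b c" "\<not> (a = 0 \<and> b = 0 \<and> c = 0)"
      using \<open>?L\<close> by (auto simp: generates_extreme_ray_def form3_mem_cone_C form3_eq_0_iff)
    fix a' b' c' assume *: "in_cone d e a' b' c'" "in_cone d e (a - a') (b - b') (c - c')"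
    have "form3 a b c = form3 a' b' c' + form3 (a - a') (b - b') (c - c')"
      by (simp add: form3_add)
    then have "\<exists>k. form3 a' b' c' = scale3 k (form3 a b c)"
      using \<open>?L\<close> * unfolding generates_extreme_ray_def form3_mem_cone_C[symmetric] by blast
    then show "\<exists>k. a' = smult k a \<and> b' = smult k b \<and> c' = smult k c"
      by (simp add: scale3_form3)
  qed
next
  assume ?R
  have part: "\<exists>k. G = scale3 k (form3 a b c)"
    if GH: "G \<in> cone_C d e" "H \<in> cone_C d e" "form3 a b c = G + H" for G H
  proof -
    obtain a' b' c' where G: "G = form3 a' b' c'" "in_cone d e a' b' c'"
      using GH(1) by (rule cone_C_cases)
    obtain a'' b'' c'' where H: "H = form3 a'' b'' c''" "in_cone d e a'' b'' c''"
      using GH(2) by (rule cone_C_cases)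
    have "a'' = a - a'" "b'' = b - b'" "c'' = c - c'"
      using GH(3) by (auto simp: G H form3_add)
    with \<open>?R\<close> G H have "\<exists>k. a' = smult k a \<and> b' = smult k b \<and> c' = smult k c" by blast
    then show ?thesis by (simp add: G scale3_form3)
  qed
  then have "\<exists>k. H = scale3 k (form3 a b c)"
    if "G \<in> cone_C d e" "H \<in> cone_C d e" "form3 a b c = G + H" for G H
    using that by (metis add.commute)
  with part \<open>?R\<close> show ?L
    by (auto simp: generates_extreme_ray_def form3_mem_cone_C form3_eq_0_iff)
qed

section \<open>Rank-one forms and their degrees\<close>

lemma poly_coprime_sum_squares_pos:
  fixes p q :: "real poly"
  assumes "coprime p q"
  shows "0 < poly p x ^ 2 + poly q x ^ 2"
proof -
  have "\<not> (poly p x = 0 \<and> poly q x = 0)"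
  proof
    assume "poly p x = 0 \<and> poly q x = 0"
    then have "[:-x, 1:] dvd p" "[:-x, 1:] dvd q" by (auto simp: poly_eq_0_iff_dvd)
    then have "is_unit [:-x, 1:]" using assms coprime_common_divisor by blast
    then show False by (simp add: is_unit_iff_degree)
  qed
  then show ?thesis by (simp add: sum_power2_gt_zero_iff)
qed

text \<open>With \<open>g = gcd b c\<close>, \<open>b = p g\<close> and \<open>c = q g\<close>, the
  hypothesis becomes \<open>a q = g p ^ 2\<close>, and coprimality puts a factor \<open>q\<close>
  into \<open>g\<close>.\<close>

lemma disc_zero_factorization:
  fixes a b c :: "real poly"
  assumes "a * c = b ^ 2"
  obtains p q r where "gcd p q = 1" "a = r * p ^ 2" "b = r * p * q" "c = r * q ^ 2"
proof (cases "c = 0")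
  case True
  with assms show thesis using that[of 1 0 a] by simp
next
  case False
  then have "gcd b c \<noteq> 0" by simp
  then obtain p q where pq: "b = p * gcd b c" "c = q * gcd b c" "coprime p q"
    using gcd_coprime_exists by blast
  define g where "g = gcd b c"
  have bc: "b = p * g" "c = q * g" "g \<noteq> 0" "q \<noteq> 0"
    using pq False by (auto simp: g_def)
  have "g * (a * q) = g * (g * p ^ 2)"
    using assms by (simp add: bc power2_eq_square mult_ac)
  then have aq: "a * q = g * p ^ 2" using bc(3) by simp
  then have "q dvd g * p ^ 2" by (metis dvd_triv_right)
  then have "q dvd g" using pq(3) by (simp add: coprime_dvd_mult_left_iff coprime_commute)
  then obtain r where r: "g = q * r" by blast
  have "q * a = q * (r * p ^ 2)" using aq by (simp add: r mult_ac)
  then have "a = r * p ^ 2" using bc(4) by simp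
  then show thesis using that[of p q r] pq(3) bc(1,2)
    by (simp add: r power2_eq_square mult_ac coprime_iff_gcd_eq_1)
qed

lemma degree_mult_power2:
  fixes r p :: "real poly"
  assumes "r \<noteq> 0" "p \<noteq> 0"
  shows "degree (r * p ^ 2) = degree r + 2 * degree p"
  using assms by (simp add: degree_mult_eq degree_power_eq)

text \<open>A zero \<open>p\<close> or \<open>q\<close> puts no bound on \<open>r\<close>, in line
  with \<open>codeg\<close> being infinite there.\<close>

lemma degree_bounds_iff_codeg:
  assumes "r \<noteq> 0"
  shows "degree (r * p ^ 2) \<le> d \<and> degree (r * q ^ 2) \<le> e \<longleftrightarrow>
    2 * degree p \<le> d \<and> 2 * degree q \<le> e \<and> enat (degree r) \<le> min (codeg d p) (codeg e q)"
  using degree_mult_power2[OF assms, of p] degree_mult_power2[OF assms, of q]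
  by (cases "p = 0"; cases "q = 0") (auto simp: codeg_def)

text \<open>Twice the middle degree is the sum of the outer ones when all factors are nonzero, so
  its bound is automatic.\<close>

lemma in_cone_rank_one:
  assumes "\<And>x. x \<in> {0..1} \<Longrightarrow> 0 \<le> poly r x"
    "degree (r * p ^ 2) \<le> d" "degree (r * q ^ 2) \<le> e"
  shows "in_cone d e (r * p ^ 2) (r * p * q) (r * q ^ 2)"
proof -
  have "degree (r * p * q) \<le> (d + e) div 2"
  proof (cases "r = 0 \<or> p = 0 \<or> q = 0")
    case False
    then have "2 * degree (r * p * q) = degree (r * p ^ 2) + degree (r * q ^ 2)"
      by (simp add: degree_mult_power2 degree_mult_eq degree_power_eq)
    then show ?thesis using assms(2,3) by linarith
  qed auto
  then show ?thesis using assms psd_form_rank_one by (simp add: in_cone_def)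
qed

section \<open>Necessity of the conditions\<close>

text \<open>The form splits along \<open>r = s + (r - s)\<close>; extremality compares coefficients,
  and a nonzero one of \<open>p\<close>, \<open>q\<close> is cancelled.\<close>

lemma extreme_rank_one_proportional:
  assumes "generates_extreme_ray (cone_C d e) (form3 (r * p ^ 2) (r * p * q) (r * q ^ 2))"
    and s: "\<And>x. x \<in> {0..1} \<Longrightarrow> 0 \<le> poly s x" "\<And>x. x \<in> {0..1} \<Longrightarrow> poly s x \<le> poly r x"
    and deg: "degree (s * p ^ 2) \<le> d" "degree (s * q ^ 2) \<le> e"
  shows "\<exists>k. s = smult k r"
proof -
  have cone: "in_cone d e (r * p ^ 2) (r * p * q) (r * q ^ 2)"
    and pq: "\<not> (p = 0 \<and> q = 0)"
    using assms(1) by (auto simp: generates_extreme_ray_form3)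
  then have deg_r: "degree (r * p ^ 2) \<le> d" "degree (r * q ^ 2) \<le> e" by (auto simp: in_cone_def)
  have "in_cone d e (s * p ^ 2) (s * p * q) (s * q ^ 2)"
    using s(1) deg by (rule in_cone_rank_one)
  moreover have "in_cone d e ((r - s) * p ^ 2) ((r - s) * p * q) ((r - s) * q ^ 2)"
    using s(2) deg deg_r
    by (intro in_cone_rank_one) (auto simp: left_diff_distrib intro: degree_diff_le)
  ultimately obtain k where "s * p ^ 2 = smult k (r * p ^ 2)" "s * q ^ 2 = smult k (r * q ^ 2)"
    using assms(1) unfolding generates_extreme_ray_form3 left_diff_distrib by blast
  then have "(s - smult k r) * p ^ 2 = 0" "(s - smult k r) * q ^ 2 = 0"
    by (simp_all add: left_diff_distrib)
  then show ?thesis using pq by auto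
qed

lemma extreme_ray_factorization:
  assumes ext: "generates_extreme_ray (cone_C d e) F"
  obtains p q r where "F = of_X r * (of_X p * var_Y + of_X q * var_Z) ^ 2"
    "\<not> (p = 0 \<and> q = 0)" "gcd p q = 1" "r \<noteq> 0" "\<forall>x\<in>{0..1}. 0 \<le> poly r x"
    "size (filter_mset (\<lambda>x. x \<in> {0..1}) (proots r)) = degree r"
    "2 * degree p \<le> d" "2 * degree q \<le> e" "enat (degree r) = min (codeg d p) (codeg e q)"
proof -
  have "F \<in> cone_C d e" using ext by (simp add: generates_extreme_ray_def)
  then obtain a b c where F: "F = form3 a b c" and cone: "in_cone d e a b c" by (rule cone_C_cases)
  have ext_abc: "\<not> (a = 0 \<and> b = 0 \<and> c = 0)"
    "\<And>a' b' c'. in_cone d e a' b' c' \<Longrightarrow> in_cone d e (a - a') (b - b') (c - c') \<Longrightarrow>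
        \<exists>k. a' = smult k a \<and> b' = smult k b \<and> c' = smult k c"
    using ext unfolding F generates_extreme_ray_form3 by blast+
  have "a * c = b ^ 2"
  proof (rule ccontr)
    assume disc: "a * c \<noteq> b ^ 2"
    obtain a' b' c' where *: "in_cone d e a' b' c'" "in_cone d e (a - a') (b - b') (c - c')"
      "a' * c' = b' ^ 2" "\<not> (a' = 0 \<and> b' = 0 \<and> c' = 0)"
      using has_rank_one_part_if_disc_neq_0[OF cone disc] by (auto simp: has_rank_one_part_def)
    obtain k where k: "a' = smult k a" "b' = smult k b" "c' = smult k c"
      using ext_abc(2) *(1,2) by blast
    then have "k \<noteq> 0" using *(4) by auto
    moreover have "smult (k ^ 2) (a * c - b ^ 2) = 0"
      using *(3) by (simp add: k smult_diff_right power2_eq_square)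
    ultimately show False using disc by simp
  qed
  then obtain p q r where pq: "gcd p q = 1" and abc: "a = r * p ^ 2" "b = r * p * q" "c = r * q ^ 2"
    by (rule disc_zero_factorization)
  have nonzero: "\<not> (p = 0 \<and> q = 0)" "r \<noteq> 0" using ext_abc(1) abc by auto
  have r_nonneg: "0 \<le> poly r x" if "x \<in> {0..1}" for x
  proof -
    \<comment> \<open>The trace is \<open>r\<close> times a positive factor, so it shows the sign of
      \<open>r\<close> even where \<open>p\<close> or \<open>q\<close> vanishes.\<close>
    have "0 \<le> poly a x + poly c x" using cone that by (simp add: in_cone_def psd_form_iff)
    also have "\<dots> = poly r x * (poly p x ^ 2 + poly q x ^ 2)" by (simp add: abc distrib_left)
    finally show ?thesis
      using poly_coprime_sum_squares_pos[of p q x] pq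
      by (simp add: zero_le_mult_iff coprime_iff_gcd_eq_1 not_le[symmetric])
  qed
  have bounds: "2 * degree p \<le> d \<and> 2 * degree q \<le> e \<and> enat (degree r) \<le> min (codeg d p) (codeg e q)"
    using cone degree_bounds_iff_codeg[OF nonzero(2), of p d q e] by (simp add: in_cone_def abc)
  have proportional: "\<exists>k. s = smult k r"
    if "\<And>x. x \<in> {0..1} \<Longrightarrow> 0 \<le> poly s x \<and> poly s x \<le> poly r x" "s \<noteq> 0"
      "enat (degree s) \<le> min (codeg d p) (codeg e q)" for s
    using that bounds degree_bounds_iff_codeg[OF that(2), of p d q e] ext
    by (intro extreme_rank_one_proportional) (auto simp: F abc)
  have "enat (degree r) = min (codeg d p) (codeg e q)"
  proof (rule ccontr)
    assume "enat (degree r) \<noteq> min (codeg d p) (codeg e q)"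
    then have "eSuc (enat (degree r)) \<le> min (codeg d p) (codeg e q)"
      using bounds by (intro ileI1) (auto simp: less_le)
    then have deg: "enat (degree ([:0, 1:] * r)) \<le> min (codeg d p) (codeg e q)"
      using nonzero(2) by (simp add: degree_mult_eq eSuc_enat)
    \<comment> \<open>\<open>X r\<close> lies between \<open>0\<close> and \<open>r\<close> on the
      interval, and the spare degree makes it admissible; but its degree forbids a multiple of
      \<open>r\<close>.\<close>
    have "\<exists>k. [:0, 1:] * r = smult k r"
      using r_nonneg nonzero(2) deg by (intro proportional) (auto simp: mult_left_le_one_le)
    then obtain k where "[:0, 1:] * r = smult k r" ..
    then have "degree ([:0, 1:] * r) \<le> degree r" using degree_smult_le[of k r] by simp
    then show False using nonzero(2) by (simp add: degree_mult_eq)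
  qed
  moreover have "size (filter_mset (\<lambda>x. x \<in> {0..1}) (proots r)) = degree r"
  proof -
    obtain A l where r: "r = (\<Prod>a\<in>#A. [:-a, 1:]) * l" and A: "set_mset A \<subseteq> {0..1}"
      and l: "\<And>x. x \<in> {0..1} \<Longrightarrow> poly l x \<noteq> 0"
      using poly_unit_interval_root_factorization[OF nonzero(2)] by blast
    obtain \<sigma> \<mu> where \<sigma>: "\<sigma> \<noteq> 0" "\<mu> > 0" "\<And>x. x \<in> {0..1} \<Longrightarrow> \<mu> \<le> \<sigma> * poly l x"
      using poly_no_root_sign[OF l] by blast
    \<comment> \<open>\<open>t\<close> collects the roots of \<open>r\<close> in the interval,
      scaled so that the remaining factor \<open>\<sigma> l\<close> is at least \<open>\<mu>\<close>
      there. Hence \<open>\<mu> t\<close> lies between \<open>0\<close> and \<open>r\<close>, and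
      proportionality makes \<open>l\<close> constant.\<close>
    define t where "t = smult (1 / \<sigma>) (\<Prod>a\<in>#A. [:-a, 1:])"
    have r_eq: "r = t * smult \<sigma> l" using \<sigma>(1) by (simp add: r t_def)
    have "t \<noteq> 0" "l \<noteq> 0" using nonzero(2) r_eq by auto
    have "\<exists>k. smult \<mu> t = smult k r"
    proof (rule proportional)
      fix x :: real assume x: "x \<in> {0..1}"
      have "0 < \<sigma> * poly l x" using \<sigma>(2) \<sigma>(3)[OF x] by linarith
      moreover have "0 \<le> poly t x * (\<sigma> * poly l x)" using r_nonneg[OF x] by (simp add: r_eq mult.left_commute)
      ultimately have "0 \<le> poly t x" by (simp add: zero_le_mult_iff)
      then have "poly t x * \<mu> \<le> poly t x * (\<sigma> * poly l x)"
        using \<sigma>(3)[OF x] by (intro mult_left_mono)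
      with \<open>0 \<le> poly t x\<close> show "0 \<le> poly (smult \<mu> t) x \<and> poly (smult \<mu> t) x \<le> poly r x"
        using \<sigma>(2) by (simp add: r_eq mult_ac)
    next
      have "degree (smult \<mu> t) \<le> degree r"
        using \<open>t \<noteq> 0\<close> \<open>l \<noteq> 0\<close> \<sigma>(1,2) by (simp add: r_eq degree_mult_eq)
      then show "enat (degree (smult \<mu> t)) \<le> min (codeg d p) (codeg e q)"
        using bounds by (meson enat_ord_simps(1) order_trans)
    qed (use \<open>t \<noteq> 0\<close> \<sigma>(2) in auto)
    then obtain k where k: "smult \<mu> t = smult k r" ..
    then have "k \<noteq> 0" using \<open>t \<noteq> 0\<close> \<sigma>(2) by auto
    then have "degree r = degree t" using arg_cong[OF k, of degree] \<sigma>(2) by simp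
    then have "degree l = 0"
      using \<open>t \<noteq> 0\<close> \<open>l \<noteq> 0\<close> \<sigma>(1) by (simp add: r_eq degree_mult_eq)
    then show ?thesis using size_unit_interval_proots[OF A l] unfolding r by blast
  qed
  ultimately show thesis
    using that[of r p q] nonzero pq r_nonneg bounds by (simp add: F abc form3_square)
qed

section \<open>Sufficiency of the conditions\<close>

text \<open>The dominating form vanishes at \<open>(q, -p)\<close>, hence so does the smaller
  nonnegative one; its Gram matrix then annihilates that vector.\<close>

lemma psd_form_kernel_subform:
  assumes "psd_form a b c" "psd_form (r * p ^ 2 - a) (r * p * q - b) (r * q ^ 2 - c)"
  shows "a * q = b * p" "b * q = c * p"
proof -
  have "poly (a * q - b * p) x = 0 \<and> poly (b * q - c * p) x = 0" if x: "x \<in> {0..1}" for x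
  proof -
    define A B D P Q where "A = poly a x" "B = poly b x" "D = poly c x" "P = poly p x" "Q = poly q x"
    note defs = this
    have "0 \<le> (poly r x * P ^ 2 - A) * Q ^ 2 + 2 * (poly r x * P * Q - B) * Q * (-P)
        + (poly r x * Q ^ 2 - D) * (-P) ^ 2"
      using assms(2)[unfolded psd_form_def, rule_format, OF x, of "poly q x" "- poly p x"]
      by (simp add: defs)
    then have le: "A * Q ^ 2 - 2 * B * P * Q + D * P ^ 2 \<le> 0"
      by (simp add: algebra_simps power2_eq_square)
    have ABD: "0 \<le> A" "0 \<le> D" "0 \<le> A * D - B ^ 2"
      using assms(1) x by (auto simp: psd_form_iff defs)
    \<comment> \<open>Both summands on the left are nonnegative, while the right side is at most
      zero.\<close>
    have "(A * Q - B * P) ^ 2 + (A * D - B ^ 2) * P ^ 2 = A * (A * Q ^ 2 - 2 * B * P * Q + D * P ^ 2)"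
      by (simp add: algebra_simps power2_eq_square)
    also have "\<dots> \<le> 0" using ABD(1) le by (rule mult_nonneg_nonpos)
    finally have "(A * Q - B * P) ^ 2 \<le> 0"
      using mult_nonneg_nonneg[OF ABD(3) zero_le_power2[of P]] by linarith
    then have "A * Q - B * P = 0" by simp
    have "(B * Q - D * P) ^ 2 + (A * D - B ^ 2) * Q ^ 2 = D * (A * Q ^ 2 - 2 * B * P * Q + D * P ^ 2)"
      by (simp add: algebra_simps power2_eq_square)
    also have "\<dots> \<le> 0" using ABD(2) le by (rule mult_nonneg_nonpos)
    finally have "(B * Q - D * P) ^ 2 \<le> 0"
      using mult_nonneg_nonneg[OF ABD(3) zero_le_power2[of Q]] by linarith
    then have "B * Q - D * P = 0" by simp
    with \<open>A * Q - B * P = 0\<close> show ?thesis by (simp add: defs)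
  qed
  then have "a * q - b * p = 0" "b * q - c * p = 0"
    by (blast intro: poly_eq_0_if_zero_on_unit_interval)+
  then show "a * q = b * p" "b * q = c * p" by simp_all
qed

text \<open>Bezout coefficients replace division: the two relations turn \<open>s p ^ 2\<close> into
  \<open>a (u p + v q) ^ 2\<close>, and likewise for the other entries.\<close>

lemma coprime_kernel_factorization:
  fixes a b c p q :: "real poly"
  assumes "gcd p q = 1" "a * q = b * p" "b * q = c * p"
  obtains s where "a = s * p ^ 2" "b = s * p * q" "c = s * q ^ 2"
proof -
  obtain u v where uv: "u * p + v * q = 1"
    using bezout_coefficients_fst_snd[of p q] assms(1) by metis
  \<comment> \<open>\<open>(u, v)\<close> is where \<open>p Y + q Z\<close> takes the value \<open>1\<close>, so \<open>s\<close> must be the value of the form there.\<close>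
  define s where "s = a * u ^ 2 + 2 * b * u * v + c * v ^ 2"
  have "s * p ^ 2 = a * (u * p + v * q) ^ 2" "s * p * q = b * (u * p + v * q) ^ 2"
    "s * q ^ 2 = c * (u * p + v * q) ^ 2"
    unfolding s_def using assms(2,3) by algebra+
  then show thesis using that[of s] uv by simp
qed

lemma generates_extreme_ray_rank_one:
  assumes nonzero: "\<not> (p = 0 \<and> q = 0)" "r \<noteq> 0" and pq: "gcd p q = 1"
    and r: "\<forall>x\<in>{0..1}. 0 \<le> poly r x"
    "size (filter_mset (\<lambda>x. x \<in> {0..1}) (proots r)) = degree r"
    and deg: "2 * degree p \<le> d" "2 * degree q \<le> e" "enat (degree r) = min (codeg d p) (codeg e q)"
  shows "generates_extreme_ray (cone_C d e) (of_X r * (of_X p * var_Y + of_X q * var_Z) ^ 2)"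
  unfolding form3_square generates_extreme_ray_form3
proof (intro conjI allI impI)
  have "degree (r * p ^ 2) \<le> d" "degree (r * q ^ 2) \<le> e"
    using degree_bounds_iff_codeg[OF nonzero(2), of p d q e] deg by simp_all
  then show "in_cone d e (r * p ^ 2) (r * p * q) (r * q ^ 2)"
    using r(1) by (intro in_cone_rank_one) auto
  show "\<not> (r * p ^ 2 = 0 \<and> r * p * q = 0 \<and> r * q ^ 2 = 0)" using nonzero by auto
  fix a b c
  assume cone: "in_cone d e a b c" and cone': "in_cone d e (r * p ^ 2 - a) (r * p * q - b) (r * q ^ 2 - c)"
  then have psd: "psd_form a b c" "psd_form (r * p ^ 2 - a) (r * p * q - b) (r * q ^ 2 - c)"
    by (auto simp: in_cone_def)
  then have "a * q = b * p" "b * q = c * p" by (rule psd_form_kernel_subform)+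
  with pq obtain s where abc: "a = s * p ^ 2" "b = s * p * q" "c = s * q ^ 2"
    by (rule coprime_kernel_factorization)
  have "\<exists>k. s = smult k r"
  proof (cases "s = 0")
    case True
    then show ?thesis by (intro exI[of _ 0]) simp
  next
    case False
    have s: "0 \<le> poly s x \<and> poly s x \<le> poly r x" if "x \<in> {0..1}" for x
    proof -
      have pos: "0 < poly p x ^ 2 + poly q x ^ 2"
        using poly_coprime_sum_squares_pos pq by (simp add: coprime_iff_gcd_eq_1)
      have "0 \<le> poly a x + poly c x" "0 \<le> poly (r * p ^ 2 - a) x + poly (r * q ^ 2 - c) x"
        using psd that unfolding psd_form_iff by (auto intro!: add_nonneg_nonneg simp del: poly_diff)
      then have "0 \<le> poly s x * (poly p x ^ 2 + poly q x ^ 2)"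
        "0 \<le> (poly r x - poly s x) * (poly p x ^ 2 + poly q x ^ 2)"
        by (simp_all add: abc algebra_simps)
      with pos show ?thesis by (auto simp: zero_le_mult_iff)
    qed
    obtain A l where r_eq: "r = (\<Prod>a\<in>#A. [:-a, 1:]) * l" and A: "set_mset A \<subseteq> {0..1}"
      and l: "\<And>x. x \<in> {0..1} \<Longrightarrow> poly l x \<noteq> 0"
      using poly_unit_interval_root_factorization[OF nonzero(2)] by blast
    have "degree l = 0" using size_unit_interval_proots[OF A l] r(2) unfolding r_eq by blast
    then obtain k where k: "l = [:k:]" by (rule degree_eq_zeroE)
    have r_eq': "r = smult k (\<Prod>a\<in>#A. [:-a, 1:])" by (simp add: r_eq k)
    \<comment> \<open>Up to a constant, \<open>r\<close> consists of linear factors at points of the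
      interval, and \<open>s\<close> inherits each of them.\<close>
    have "(\<Prod>a\<in>#A. [:-a, 1:]) dvd s"
    proof (rule dvd_if_dominated_and_split[OF A, of s k])
      fix x :: real assume "x \<in> {0..1}"
      from s[OF this] have "\<bar>poly s x\<bar> \<le> \<bar>poly r x\<bar>" by linarith
      then show "\<bar>poly s x\<bar> \<le> \<bar>poly (smult k (\<Prod>a\<in>#A. [:-a, 1:])) x\<bar>" unfolding r_eq' .
    qed
    moreover have "k \<noteq> 0" using nonzero(2) r_eq' by auto
    ultimately have "r dvd s" unfolding r_eq' by (rule smult_dvd)
    then obtain m where m: "s = r * m" by blast
    have "degree (s * p ^ 2) \<le> d" "degree (s * q ^ 2) \<le> e"
      using cone by (auto simp: in_cone_def abc)
    \<comment> \<open>\<open>deg(3)\<close> makes \<open>degree r\<close> the largest degree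
      admissible for \<open>s\<close>, so the cofactor \<open>m\<close> is constant.\<close>
    then have "enat (degree s) \<le> enat (degree r)"
      using degree_bounds_iff_codeg[OF False, of p d q e] deg(3) by simp
    moreover have "degree s = degree r + degree m"
      unfolding m using False m by (intro degree_mult_eq) auto
    ultimately have "degree m = 0" by simp
    then obtain j where "m = [:j:]" by (rule degree_eq_zeroE)
    then show ?thesis using m by (intro exI[of _ j]) simp
  qed
  then obtain k where "s = smult k r" ..
  then show "\<exists>k. a = smult k (r * p ^ 2) \<and> b = smult k (r * p * q) \<and> c = smult k (r * q ^ 2)"
    by (intro exI[of _ k]) (simp add: abc)
qed

theorem theorem7:
  fixes d e :: nat
  assumes "d mod 2 = e mod 2"
  shows "extreme_rays (cone_C d e) =
    {ray (of_X r * (of_X p * var_Y + of_X q * var_Z) ^ 2) |p q r :: real poly.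
       \<not> (p = 0 \<and> q = 0) \<and> gcd p q = 1 \<and>
       r \<noteq> 0 \<and> (\<forall>x\<in>{0..1}. 0 \<le> poly r x) \<and>
       size (filter_mset (\<lambda>x. x \<in> {0..1}) (proots r)) = degree r \<and>
       2 * degree p \<le> d \<and> 2 * degree q \<le> e \<and>
       enat (degree r) = min (codeg d p) (codeg e q)}"
  (is "_ = ?R")
proof (intro equalityI subsetI)
  fix \<rho> assume "\<rho> \<in> extreme_rays (cone_C d e)"
  then obtain F where F: "\<rho> = ray F" "generates_extreme_ray (cone_C d e) F"
    by (auto simp: extreme_rays_def)
  obtain p q r where pqr: "F = of_X r * (of_X p * var_Y + of_X q * var_Z) ^ 2"
    "\<not> (p = 0 \<and> q = 0)" "gcd p q = 1" "r \<noteq> 0" "\<forall>x\<in>{0..1}. 0 \<le> poly r x"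
    "size (filter_mset (\<lambda>x. x \<in> {0..1}) (proots r)) = degree r"
    "2 * degree p \<le> d" "2 * degree q \<le> e" "enat (degree r) = min (codeg d p) (codeg e q)"
    using F(2) by (rule extreme_ray_factorization)
  show "\<rho> \<in> ?R" unfolding F(1) pqr(1)
    by (rule CollectI, rule exI[of _ p], rule exI[of _ q], rule exI[of _ r]) (intro conjI refl pqr(2-))
next
  fix \<rho> assume "\<rho> \<in> ?R"
  then obtain p q r where \<rho>: "\<rho> = ray (of_X r * (of_X p * var_Y + of_X q * var_Z) ^ 2)"
    and pqr: "\<not> (p = 0 \<and> q = 0)" "gcd p q = 1" "r \<noteq> 0" "\<forall>x\<in>{0..1}. 0 \<le> poly r x"
    "size (filter_mset (\<lambda>x. x \<in> {0..1}) (proots r)) = degree r"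
    "2 * degree p \<le> d" "2 * degree q \<le> e" "enat (degree r) = min (codeg d p) (codeg e q)"
    by (elim CollectE exE conjE) (rule that; assumption)
  from pqr have "generates_extreme_ray (cone_C d e) (of_X r * (of_X p * var_Y + of_X q * var_Z) ^ 2)"
    by (intro generates_extreme_ray_rank_one)
  then show "\<rho> \<in> extreme_rays (cone_C d e)"
    unfolding extreme_rays_def \<rho> by blast
qed

end
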